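(* Let $t\ge 2$ be a fixed integer. Let $A=A^{(m)}\in \mathrm{Avoid}(m,Q_3(t))$ (one matrix for each $m$) with $|A|=\omega(m\log m)$ as $m\to\infty$. Then (for all sufficiently large $m$) there exist a set of positive integers $\{k_1,\ldots,k_y\}$ and a set $\{A'_1,\ldots,A'_y\}$ of configurations $A'_j\prec A$ (each $A'_j$ being given by a set of rows and a set of columns of $A$) such that: 1. $k_{j+1}\le \frac12 k_j$ for all $1\le j<y$, and $y\le \log m$. 2. For each $j$ there exist $k_j$ rows of $A$ such that the columns of $A'_j$ restricted to these rows are columns of $I_{k_j}$ (where $I_{k_j}$ is written with respect to a fixed ordering of these rows). 3. For each $j$ and each column index $i$ of $I_{k_j}$, let $C_i^j$ be the set of columns of $A'_j$ that are equal to the $i$th column of $I_{k_j}$ in the $k_j$ rows of item 2. Then no row of $A'_j$ restricted to $C_i^j$ is dense, and every column of $C_i^j$ is identified by some sparse row (that is, by a row of $A'_j$ that is sparse when restricted to $C_i^j$). 4. $|A|=\Theta\left(\sum_{j=1}^{y} |A'_j|\right)$ as $m\to\infty$.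
   Context: A matrix is simple if it is a $(0,1)$-matrix with no repeated columns. $F\prec A$ ($F$ is a configuration in $A$) means that some submatrix of $A$ is a row and column permutation of $F$. $|A|$ is the number of columns of $A$. $\mathrm{Avoid}(m,F)$ is the set of $m$-rowed simple matrices $A$ with $F\nprec A$. $I_k$ is the $k\times k$ identity matrix. For $t\ge 2$, $Q_3(t)$ is the $2\times(2t+2)$ matrix whose columns are: $\begin{bmatrix}0\\0\end{bmatrix}$ once, $\begin{bmatrix}1\\0\end{bmatrix}$ exactly $t$ times, $\begin{bmatrix}0\\1\end{bmatrix}$ exactly $t$ times, and $\begin{bmatrix}1\\1\end{bmatrix}$ once. Here $\log$ is to base 2. Terminology (depending on $t$): a row $r$ is sparse when restricted to a set of columns $C$ if, within $C$, $r$ has at least one $0$ but fewer than $t$ $0$'s. A row $r$ is dense when restricted to $C$ if, within $C$, $r$ has at least one $1$ and at least $t$ $0$'s. A column $c\in C$ is identified by a row $r$ that is sparse restricted to $C$ if $r$ has a $0$ in column $c$. *)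

theory Defs
  imports
    Complex_Main
    "HOL-Library.Landau_Symbols"
    "HOL-Combinatorics.Permutations"
    "Jordan_Normal_Form.Matrix"
    "Jordan_Normal_Form.DL_Submatrix"
begin

definition simple_matrix :: "nat mat \<Rightarrow> bool" where
  "simple_matrix A \<longleftrightarrow> elements_mat A \<subseteq> {0, 1} \<and> distinct (cols A)"

definition is_configuration :: "nat mat \<Rightarrow> nat mat \<Rightarrow> bool" where
  "is_configuration F A \<longleftrightarrow>
     (\<exists>I J p q. I \<subseteq> {..<dim_row A} \<and> J \<subseteq> {..<dim_col A} \<and>
        p permutes {..<dim_row F} \<and> q permutes {..<dim_col F} \<and>
        submatrix A I J = mat (dim_row F) (dim_col F) (\<lambda>(i, j). F $$ (p i, q j)))"

definition Avoid :: "nat \<Rightarrow> nat mat \<Rightarrow> nat mat set" where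
  "Avoid m F = {A. dim_row A = m \<and> simple_matrix A \<and> \<not> is_configuration F A}"

(* The inner lists are the columns. *)
definition Q3 :: "nat \<Rightarrow> nat mat" where
  "Q3 t = mat_of_cols_list 2 ([[0, 0]] @ replicate t [1, 0] @ replicate t [0, 1] @ [[1, 1]])"

(* In the following, r is a row index and C a set of column indices of A. *)

definition sparse_row :: "nat \<Rightarrow> nat mat \<Rightarrow> nat set \<Rightarrow> nat \<Rightarrow> bool" where
  "sparse_row t A C r \<longleftrightarrow>
     (\<exists>c\<in>C. A $$ (r, c) = 0) \<and> card {c \<in> C. A $$ (r, c) = 0} < t"

definition dense_row :: "nat \<Rightarrow> nat mat \<Rightarrow> nat set \<Rightarrow> nat \<Rightarrow> bool" where
  "dense_row t A C r \<longleftrightarrow>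
     (\<exists>c\<in>C. A $$ (r, c) = 1) \<and> card {c \<in> C. A $$ (r, c) = 0} \<ge> t"

definition identified_by :: "nat \<Rightarrow> nat mat \<Rightarrow> nat set \<Rightarrow> nat \<Rightarrow> nat \<Rightarrow> bool" where
  "identified_by t A C c r \<longleftrightarrow> sparse_row t A C r \<and> c \<in> C \<and> A $$ (r, c) = 0"

(* Column c of A restricted to the rows \<rho> 0, ..., \<rho> (k - 1), in this order. *)
definition restricted_col :: "nat mat \<Rightarrow> nat \<Rightarrow> (nat \<Rightarrow> nat) \<Rightarrow> nat \<Rightarrow> nat vec" where
  "restricted_col A k \<rho> c = vec k (\<lambda>l. A $$ (\<rho> l, c))"

(* The columns, among the column indices C, that equal the i-th column of the k x k identity
   matrix on the rows \<rho> 0, ..., \<rho> (k - 1).  Identity columns are indexed by 0, ..., k - 1. *)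
definition id_class :: "nat mat \<Rightarrow> nat set \<Rightarrow> nat \<Rightarrow> (nat \<Rightarrow> nat) \<Rightarrow> nat \<Rightarrow> nat set" where
  "id_class A C k \<rho> i = {c \<in> C. restricted_col A k \<rho> c = col (1\<^sub>m k) i}"

end

theory Submission
  imports Defs "HOL-Library.Discrete_Functions"
begin

text \<open>
  Call a row light if at most half of its entries are 1. Avoiding \<open>Q3 t\<close> makes the supports of any
  two light rows disjoint or nested up to fewer than \<open>t\<close> columns, and likewise the zero sets of the
  other (heavy) rows; a support \<open>X\<close> of a light row and a zero set \<open>Z\<close> of a heavy row are nested or
  meet in fewer than \<open>t\<close> columns. Deleting at most \<open>t m\<close> columns makes both families exactly
  laminar.

  A column is determined by the smallest \<open>X\<close> and the smallest \<open>Z\<close> containing it, and all but at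
  most \<open>m + 2\<close> columns have these two sets incomparable. Such a column is assigned to the largest
  \<open>X\<close> that contains it but does not contain its \<open>Z\<close>; then \<open>Z\<close> is sparse on \<open>X\<close> and identifies
  the column. Grouping the sets \<open>X\<close> by the binary logarithm of the number of columns assigned to
  them, at least half of each group is minimal, up to a loss of \<open>O(t m)\<close> columns. Minimal sets are
  disjoint, so their rows form an identity matrix on the assigned columns. Since the sets in a group
  have nearly equal weight, each such antichain can be trimmed to a power of 2, and antichains of
  the same size are dominated by the one of largest weight.
\<close>

section \<open>Laminar families\<close>

definition laminar :: "'a set set \<Rightarrow> bool" where
  "laminar F \<longleftrightarrow> (\<forall>X\<in>F. \<forall>Y\<in>F. X \<inter> Y = {} \<or> X \<subseteq> Y \<or> Y \<subseteq> X)"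

lemma laminarD: "laminar F \<Longrightarrow> X \<in> F \<Longrightarrow> Y \<in> F \<Longrightarrow> X \<inter> Y \<noteq> {} \<Longrightarrow> X \<subseteq> Y \<or> Y \<subseteq> X"
  unfolding laminar_def by blast

lemma laminar_subset: "laminar F \<Longrightarrow> G \<subseteq> F \<Longrightarrow> laminar G"
  unfolding laminar_def by blast

lemma laminar_insert:
  assumes "laminar F" "\<And>X. X \<in> F \<Longrightarrow> X \<inter> Y = {} \<or> X \<subseteq> Y \<or> Y \<subseteq> X"
  shows "laminar (insert Y F)"
  unfolding laminar_def
proof (intro ballI)
  fix A B assume "A \<in> insert Y F" "B \<in> insert Y F"
  then consider "A = Y" "B = Y" | "A = Y" "B \<in> F" | "A \<in> F" "B = Y" | "A \<in> F" "B \<in> F" by blast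
  then show "A \<inter> B = {} \<or> A \<subseteq> B \<or> B \<subseteq> A"
  proof cases
    case 4
    then show ?thesis using assms(1) unfolding laminar_def by blast
  qed (use assms(2)[of A] assms(2)[of B] in blast)+
qed

lemma laminar_restrict: "laminar F \<Longrightarrow> laminar ((\<lambda>X. X - D) ` F)"
  unfolding laminar_def by blast

text \<open>Members of a laminar family with a common point form a chain; this yields the smallest
  and the largest of them.\<close>

lemma finite_chain_Inter_Union:
  assumes "finite G" "G \<noteq> {}" "\<And>X Y. X \<in> G \<Longrightarrow> Y \<in> G \<Longrightarrow> X \<subseteq> Y \<or> Y \<subseteq> X"
  shows "\<Inter>G \<in> G" "\<Union>G \<in> G"
proof -
  have "\<Inter>G \<in> G \<and> \<Union>G \<in> G"
    using assms
  proof (induction rule: finite_ne_induct)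
    case (insert X G)
    then have "\<Inter>G \<in> G" "\<Union>G \<in> G" by blast+
    with insert.prems[of X "\<Inter>G"] insert.prems[of X "\<Union>G"] show ?case
      by (auto simp: Int_absorb1 Int_absorb2 Un_absorb1 Un_absorb2)
  qed simp
  then show "\<Inter>G \<in> G" "\<Union>G \<in> G" by blast+
qed

text \<open>Induction removing a smallest set \<open>X s\<close>: after deleting the fewer than \<open>t\<close> points by which
  it exceeds the smallest remaining set that it meets, it lies inside every set that it meets.\<close>

lemma laminar_deletion:
  fixes X :: "'i \<Rightarrow> 'a set"
  assumes "finite S" "\<And>i. i \<in> S \<Longrightarrow> finite (X i)"
    and "\<And>i j. i \<in> S \<Longrightarrow> j \<in> S \<Longrightarrow>
      X i \<inter> X j = {} \<or> card (X i - X j) < t \<or> card (X j - X i) < t"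
  shows "\<exists>D. D \<subseteq> \<Union>(X ` S) \<and> card D \<le> t * card S \<and> laminar ((\<lambda>i. X i - D) ` S)"
  using assms
proof (induction "card S" arbitrary: S)
  case 0
  then show ?case by (auto simp: laminar_def)
next
  case (Suc n)
  then have "S \<noteq> {}" by auto
  obtain s where s: "s \<in> S" "\<And>i. i \<in> S \<Longrightarrow> card (X s) \<le> card (X i)"
  proof (rule that[of "arg_min_on (\<lambda>i. card (X i)) S"])
    show "arg_min_on (\<lambda>i. card (X i)) S \<in> S"
      by (rule arg_min_if_finite(1)[OF Suc.prems(1) \<open>S \<noteq> {}\<close>])
  qed (rule arg_min_least[OF Suc.prems(1) \<open>S \<noteq> {}\<close>])
  define S' where "S' = S - {s}"
  have S': "S' \<subseteq> S" "finite S'" "card S' = n" "S = insert s S'" "s \<notin> S'"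
    using s Suc.hyps(2) Suc.prems(1) by (auto simp: S'_def)
  obtain D' where D': "D' \<subseteq> \<Union>(X ` S')" "card D' \<le> t * n" "laminar ((\<lambda>i. X i - D') ` S')"
  proof -
    have "\<exists>D\<subseteq>\<Union>(X ` S'). card D \<le> t * card S' \<and> laminar ((\<lambda>i. X i - D) ` S')"
      by (rule Suc.hyps(1)) (use S' Suc.prems(2,3) in blast)+
    then show thesis using that S'(3) by blast
  qed
  define T where "T = {j \<in> S'. (X j \<inter> X s) - D' \<noteq> {}}"
  show ?case
  proof (cases "T = {}")
    case True
    then have *: "(X j - D') \<inter> (X s - D') = {}" if "j \<in> S'" for j
      using that by (auto simp: T_def)
    have "laminar ((\<lambda>i. X i - D') ` S)"
      unfolding S'(4) image_insert by (rule laminar_insert[OF D'(3)]) (use * in blast)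
    moreover have "card D' \<le> t * card S" using D'(2) Suc.hyps(2) by (simp flip: Suc.hyps(2))
    ultimately show ?thesis using D'(1) S'(1) by (meson SUP_subset_mono order_refl order_trans)
  next
    case False
    have "finite T" using S' by (simp add: T_def)
    obtain j where j: "j \<in> T" "\<And>i. i \<in> T \<Longrightarrow> card (X j - D') \<le> card (X i - D')"
    proof (rule that[of "arg_min_on (\<lambda>i. card (X i - D')) T"])
      show "arg_min_on (\<lambda>i. card (X i - D')) T \<in> T"
        by (rule arg_min_if_finite(1)[OF \<open>finite T\<close> False])
    qed (rule arg_min_least[OF \<open>finite T\<close> False])
    then have jS: "j \<in> S'" "j \<in> S" "X s \<inter> X j \<noteq> {}" using S' by (auto simp: T_def)
    have fin: "finite (X s)" "finite (X j)" using Suc.prems(2) s jS by auto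
    \<comment> \<open>\<open>X s\<close> has least size, so \<open>X s - X j\<close> is the smaller
      of the two differences.\<close>
    have small: "card (X s - X j) < t"
    proof -
      have "card (X s - X j) \<le> card (X j - X s)"
        using s(2)[OF jS(2)] fin by (simp add: card_Diff_subset_Int Int_commute)
      then show ?thesis using Suc.prems(3)[OF s(1) jS(2)] jS(3) by linarith
    qed
    define D where "D = D' \<union> (X s - X j)"
    have "card D \<le> card D' + card (X s - X j)"
      unfolding D_def by (rule card_Un_le)
    also have "\<dots> \<le> t * card S" using D'(2) small Suc.hyps(2) by (simp flip: Suc.hyps(2))
    finally have cD: "card D \<le> t * card S" .
    have lam: "laminar ((\<lambda>i. X i - D) ` S')"
    proof -
      have "laminar ((\<lambda>Y. Y - (X s - X j)) ` ((\<lambda>i. X i - D') ` S'))"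
        by (rule laminar_restrict[OF D'(3)])
      moreover have "(\<lambda>Y. Y - (X s - X j)) ` ((\<lambda>i. X i - D') ` S') = (\<lambda>i. X i - D) ` S'"
        by (force simp: D_def image_image)
      ultimately show ?thesis by simp
    qed
    \<comment> \<open>A point of \<open>X s\<close> outside \<open>D\<close> lies in
      \<open>X j\<close>, so \<open>X i\<close> and \<open>X j\<close> meet outside
      \<open>D'\<close> and are comparable there; the choice of \<open>j\<close> leaves only
      \<open>X j - D' \<subseteq> X i - D'\<close>.\<close>
    have key: "X s - D \<subseteq> X i - D" if "i \<in> S'" "(X i - D) \<inter> (X s - D) \<noteq> {}" for i
    proof -
      have iT: "i \<in> T" using that by (auto simp: T_def D_def)
      have "(X i - D') \<inter> (X j - D') \<noteq> {}" using that(2) by (auto simp: D_def)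
      then have "X i - D' \<subseteq> X j - D' \<or> X j - D' \<subseteq> X i - D'"
        by (rule laminarD[OF D'(3) imageI[OF that(1)] imageI[OF jS(1)]])
      moreover have "X i - D' = X j - D'" if "X i - D' \<subseteq> X j - D'"
        using that j(2)[OF iT] fin by (meson card_seteq finite_Diff)
      ultimately have "X j - D' \<subseteq> X i - D'" by auto
      then show ?thesis by (auto simp: D_def)
    qed
    have "laminar ((\<lambda>i. X i - D) ` S)"
      unfolding S'(4) image_insert by (rule laminar_insert[OF lam]) (use key in blast)
    moreover have "D \<subseteq> \<Union>(X ` S)" using D'(1) S' by (auto simp: D_def)
    ultimately show ?thesis using cD by blast
  qed
qed

text \<open>By laminarity a nonempty set has at most one parent, so the families of children are
  disjoint. With at least two children each, the non-minimal members are at most half of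
  \<open>E\<close>.\<close>

lemma card_le_twice_card_minimal:
  assumes "finite E" "{} \<notin> E" "laminar E"
    and two: "\<And>c. c \<in> E \<Longrightarrow> \<exists>d\<in>E. d \<subset> c \<Longrightarrow>
      2 \<le> card {d \<in> E. d \<subset> c \<and> (\<forall>e\<in>E. d \<subset> e \<longrightarrow> \<not> e \<subset> c)}"
  shows "card E \<le> 2 * card {c \<in> E. \<forall>d\<in>E. \<not> d \<subset> c}"
proof -
  define I where "I = {c \<in> E. \<exists>d\<in>E. d \<subset> c}"
  define ch where "ch c = {d \<in> E. d \<subset> c \<and> (\<forall>e\<in>E. d \<subset> e \<longrightarrow> \<not> e \<subset> c)}" for c
  have fin: "finite I" "\<And>c. finite (ch c)" using assms(1) by (auto simp: I_def ch_def)
  have "ch c \<inter> ch c' = {}" if "c \<in> I" "c' \<in> I" "c \<noteq> c'" for c c'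
  proof (rule ccontr)
    assume "ch c \<inter> ch c' \<noteq> {}"
    then obtain d where d: "d \<in> ch c" "d \<in> ch c'" by blast
    then have "d \<in> E" "d \<subseteq> c \<inter> c'" unfolding ch_def by blast+
    then have "c \<inter> c' \<noteq> {}" using assms(2) by (metis subset_empty)
    then have "c \<subseteq> c' \<or> c' \<subseteq> c" using that assms(3) by (auto simp: laminar_def I_def)
    then show False using d that by (auto simp: ch_def I_def)
  qed
  then have "card (\<Union>c\<in>I. ch c) = (\<Sum>c\<in>I. card (ch c))"
    using fin by (intro card_UN_disjoint) auto
  moreover have "card (\<Union>c\<in>I. ch c) \<le> card E"
    using assms(1) by (intro card_mono) (auto simp: ch_def)
  moreover have "(\<Sum>c\<in>I. 2) \<le> (\<Sum>c\<in>I. card (ch c))"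
    using two by (intro sum_mono) (auto simp: I_def ch_def)
  ultimately have "2 * card I \<le> card E" by simp
  moreover have "{c \<in> E. \<forall>d\<in>E. \<not> d \<subset> c} = E - I" by (auto simp: I_def)
  moreover have "card (E - I) = card E - card I"
    using fin by (intro card_Diff_subset) (auto simp: I_def)
  ultimately show ?thesis by simp
qed

section \<open>Sums over distinct powers of two\<close>

lemma sum_power2_le:
  fixes B :: "nat set"
  assumes "finite B" "\<And>b. b \<in> B \<Longrightarrow> b \<le> M"
  shows "(\<Sum>b\<in>B. 2 ^ b) \<le> (2 * 2 ^ M :: nat)"
proof -
  have "(\<Sum>b\<in>B. 2 ^ b) \<le> (\<Sum>b\<in>{..<Suc M}. 2 ^ b :: nat)"
    using assms by (intro sum_mono2) (auto simp: less_Suc_eq_le)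
  also have "\<dots> \<le> 2 * 2 ^ M" 
    using sum_power2[of "Suc M"] by (simp add: lessThan_atLeast0)
  finally show ?thesis .
qed

text \<open>Each value is less than twice its power of 2; these powers are distinct and at most
  \<open>T\<close>, so they sum to at most \<open>2 * T\<close>.\<close>

lemma sum_le_if_inj_floor_log:
  fixes f :: "'b \<Rightarrow> nat"
  assumes "finite D" "inj_on (\<lambda>d. floor_log (f d)) D"
    and "\<And>d. d \<in> D \<Longrightarrow> 0 < f d" "\<And>d. d \<in> D \<Longrightarrow> f d \<le> T"
  shows "(\<Sum>d\<in>D. f d) \<le> 4 * T"
proof (cases "D = {}")
  case False
  then have T: "T > 0" using assms(3,4) by fastforce
  have "(\<Sum>d\<in>D. f d) \<le> (\<Sum>d\<in>D. 2 * 2 ^ floor_log (f d))"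
    using assms(3) floor_log_exp2_gt by (intro sum_mono) (simp add: less_imp_le)
  also have "\<dots> = 2 * (\<Sum>b\<in>(\<lambda>d. floor_log (f d)) ` D. 2 ^ b)"
    using assms(2) by (simp add: sum.reindex sum_distrib_left)
  also have "(\<Sum>b\<in>(\<lambda>d. floor_log (f d)) ` D. 2 ^ b) \<le> (2 * 2 ^ floor_log T :: nat)"
    using assms(1,4) by (intro sum_power2_le) (auto intro: floor_log_le_iff)
  also have "2 * (2 * 2 ^ floor_log T) \<le> 4 * T"
    using floor_log_exp2_le[OF T] by simp
  finally show ?thesis by simp
qed simp

section \<open>Two crossing laminar families\<close>

text \<open>\<open>Om\<close> stands for the columns kept, \<open>XX\<close> for the trimmed
  supports of light rows, \<open>ZZ\<close> for the trimmed zero sets of heavy rows;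
  \<open>sep\<close> says that no column is repeated.\<close>

locale crossing_laminar =
  fixes Om :: "'a set" and XX ZZ :: "'a set set" and t :: nat
  assumes finite_Om: "finite Om"
    and XX_sub: "XX \<subseteq> Pow Om" and ZZ_sub: "ZZ \<subseteq> Pow Om"
    and XX_ne: "{} \<notin> XX"
    and XX_lam: "laminar XX" and ZZ_lam: "laminar ZZ"
    and cross: "\<And>X Z. X \<in> XX \<Longrightarrow> Z \<in> ZZ \<Longrightarrow> X \<subseteq> Z \<or> Z \<subseteq> X \<or> card (X \<inter> Z) < t"
    and sep: "\<And>x y. x \<in> Om \<Longrightarrow> y \<in> Om \<Longrightarrow> (\<And>X. X \<in> XX \<Longrightarrow> x \<in> X \<longleftrightarrow> y \<in> X) \<Longrightarrow>
      (\<And>Z. Z \<in> ZZ \<Longrightarrow> x \<in> Z \<longleftrightarrow> y \<in> Z) \<Longrightarrow> x = y"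
begin

lemma finite_XX: "finite XX" and finite_ZZ: "finite ZZ"
  using XX_sub ZZ_sub finite_Om by (auto intro: finite_subset)

lemma finite_X: "X \<in> XX \<Longrightarrow> finite X" and finite_Z: "Z \<in> ZZ \<Longrightarrow> finite Z"
  using XX_sub ZZ_sub finite_Om by (auto intro: finite_subset)

section \<open>Good points\<close>

definition Xm :: "'a \<Rightarrow> 'a set" where "Xm x = \<Inter>{X \<in> XX. x \<in> X}"

definition Zm :: "'a \<Rightarrow> 'a set" where "Zm x = \<Inter>{Z \<in> ZZ. x \<in> Z}"

text \<open>Since \<open>\<Inter>{}\<close> is the universal set, a good point lies in a member of both families.\<close>

definition Good :: "'a set" where
  "Good = {x \<in> Om. \<not> Xm x \<subseteq> Zm x \<and> \<not> Zm x \<subseteq> Xm x}"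

lemma mem_Xm: "x \<in> Xm x" and mem_Zm: "x \<in> Zm x"
  by (auto simp: Xm_def Zm_def)

lemma mem_X_iff: "X \<in> XX \<Longrightarrow> x \<in> X \<longleftrightarrow> Xm x \<subseteq> X"
  and mem_Z_iff: "Z \<in> ZZ \<Longrightarrow> x \<in> Z \<longleftrightarrow> Zm x \<subseteq> Z"
  by (auto simp: Xm_def Zm_def)

lemma Xm_in: "Xm x \<in> insert UNIV XX"
proof (cases "{X \<in> XX. x \<in> X} = {}")
  case False
  have "Xm x \<in> {X \<in> XX. x \<in> X}"
    unfolding Xm_def
    by (rule finite_chain_Inter_Union(1)) (use False finite_XX XX_lam in \<open>auto simp: laminar_def\<close>)
  then show ?thesis by simp
qed (simp add: Xm_def del: Collect_empty_eq)

lemma Zm_in: "Zm x \<in> insert UNIV ZZ"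
proof (cases "{Z \<in> ZZ. x \<in> Z} = {}")
  case False
  have "Zm x \<in> {Z \<in> ZZ. x \<in> Z}"
    unfolding Zm_def
    by (rule finite_chain_Inter_Union(1)) (use False finite_ZZ ZZ_lam in \<open>auto simp: laminar_def\<close>)
  then show ?thesis by simp
qed (simp add: Zm_def del: Collect_empty_eq)

lemma Good_in:
  assumes "x \<in> Good"
  shows "Xm x \<in> XX" "Zm x \<in> ZZ"
  using Xm_in[of x] Zm_in[of x] assms by (auto simp: Good_def)

text \<open>A point \<open>x\<close> with \<open>Xm x \<subseteq> Zm x\<close> is determined by \<open>Xm x\<close>: the members of the
  second family that contain \<open>x\<close> are those that contain \<open>Xm x\<close>.\<close>

lemma card_not_Good: "card (Om - Good) \<le> card XX + card ZZ + 2"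
proof -
  define B1 where "B1 = {x \<in> Om. Xm x \<subseteq> Zm x}"
  define B2 where "B2 = {x \<in> Om. Zm x \<subseteq> Xm x}"
  have 1: "inj_on Xm B1"
  proof (rule inj_onI)
    fix x y assume xy: "x \<in> B1" "y \<in> B1" "Xm x = Xm y"
    show "x = y"
    proof (rule sep)
      show "x \<in> Z \<longleftrightarrow> y \<in> Z" if "Z \<in> ZZ" for Z
        using xy mem_Z_iff[OF that] mem_Xm[of x] mem_Xm[of y] unfolding B1_def by blast
    qed (use xy mem_X_iff in \<open>auto simp: B1_def\<close>)
  qed
  have 2: "inj_on Zm B2"
  proof (rule inj_onI)
    fix x y assume xy: "x \<in> B2" "y \<in> B2" "Zm x = Zm y"
    show "x = y"
    proof (rule sep)
      show "x \<in> X \<longleftrightarrow> y \<in> X" if "X \<in> XX" for X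
        using xy mem_X_iff[OF that] mem_Zm[of x] mem_Zm[of y] unfolding B2_def by blast
    qed (use xy mem_Z_iff in \<open>auto simp: B2_def\<close>)
  qed
  \<comment> \<open>The value \<open>UNIV\<close>, taken at points outside every member, adds 1 for
    each family.\<close>
  have "card B1 \<le> card (insert UNIV XX)"
    using 1 Xm_in finite_XX by (intro card_inj_on_le) auto
  moreover have "card B2 \<le> card (insert UNIV ZZ)"
    using 2 Zm_in finite_ZZ by (intro card_inj_on_le) auto
  moreover have "card (Om - Good) \<le> card (B1 \<union> B2)"
    using finite_Om by (intro card_mono) (auto simp: B1_def B2_def Good_def)
  moreover have "card (B1 \<union> B2) \<le> card B1 + card B2" by (rule card_Un_le)
  moreover have "card (insert UNIV XX) \<le> card XX + 1" "card (insert UNIV ZZ) \<le> card ZZ + 1"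
    using finite_XX finite_ZZ by (auto simp: card_insert_if)
  ultimately show ?thesis by linarith
qed

text \<open>\<open>above (tp x)\<close> depends only on \<open>Zm x\<close> (see \<open>above_tp\<close>), so a member of \<open>ZZ\<close> contributes fewer
  than \<open>t\<close> points to each of the children of a single node of the tree \<open>XX\<close>.\<close>

definition tp :: "'a \<Rightarrow> 'a set" where
  "tp x = \<Union>{X \<in> XX. x \<in> X \<and> \<not> Zm x \<subseteq> X}"

text \<open>The sets united contain \<open>x\<close>, hence form a chain, and \<open>Xm x\<close> is
  one of them because \<open>x\<close> is good. So \<open>tp x\<close> contains \<open>Xm x\<close>
  and is not inside \<open>Zm x\<close>, which leaves only the third case of
  \<open>cross\<close>.\<close>

lemma tp_props:
  assumes "x \<in> Good"
  shows "tp x \<in> XX" "x \<in> tp x" "\<not> Zm x \<subseteq> tp x" "card (tp x \<inter> Zm x) < t"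
    and tp_max: "\<And>X. X \<in> XX \<Longrightarrow> x \<in> X \<Longrightarrow> \<not> Zm x \<subseteq> X \<Longrightarrow> X \<subseteq> tp x"
proof -
  let ?G = "{X \<in> XX. x \<in> X \<and> \<not> Zm x \<subseteq> X}"
  have X: "Xm x \<in> ?G" using Good_in[OF assms] mem_Xm assms by (auto simp: Good_def)
  have "tp x \<in> ?G"
    unfolding tp_def
    by (rule finite_chain_Inter_Union(2)) (use X finite_XX XX_lam in \<open>auto simp: laminar_def\<close>)
  then show *: "tp x \<in> XX" "x \<in> tp x" "\<not> Zm x \<subseteq> tp x" by auto
  have "Xm x \<subseteq> tp x" using X by (auto simp: tp_def)
  then have "\<not> tp x \<subseteq> Zm x" using assms by (auto simp: Good_def)
  then show "card (tp x \<inter> Zm x) < t" using cross[OF *(1) Good_in(2)[OF assms]] *(3) by blast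
  show "X \<subseteq> tp x" if "X \<in> XX" "x \<in> X" "\<not> Zm x \<subseteq> X" for X
    using that by (auto simp: tp_def)
qed

section \<open>Weights of the members of \<open>XX\<close>\<close>

definition K :: "'a set \<Rightarrow> 'a set" where "K c = {x \<in> Good. tp x = c}"

definition w :: "'a set \<Rightarrow> nat" where "w c = card (K c)"

text \<open>The ancestors of \<open>c\<close> in the forest \<open>XX\<close>; members with equal
  \<open>above\<close> are siblings, roots included.\<close>

definition above :: "'a set \<Rightarrow> 'a set set" where "above c = {X \<in> XX. c \<subset> X}"

text \<open>Each \<open>Z\<close> is counted for exactly one \<open>P\<close>, which bounds the
  total by \<open>card ZZ\<close>.\<close>

definition mult :: "'a set set \<Rightarrow> nat" where "mult P = card {Z \<in> ZZ. {X \<in> XX. Z \<subseteq> X} = P}"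

lemma K_sub: "K c \<subseteq> c" "K c \<subseteq> Good"
  using tp_props(2) by (auto simp: K_def)

lemma finite_Good: "finite Good"
  using finite_Om by (simp add: Good_def)

lemma finite_K: "finite (K c)"
  using K_sub(2) finite_Good by (rule finite_subset)

lemma sum_w: "card Good = (\<Sum>c\<in>{c \<in> XX. 0 < w c}. w c)"
proof -
  have "Good = (\<Union>c\<in>XX. K c)" using tp_props(1) by (auto simp: K_def)
  moreover have "card (\<Union>c\<in>XX. K c) = (\<Sum>c\<in>XX. w c)"
    unfolding w_def using finite_XX finite_K by (intro card_UN_disjoint) (auto simp: K_def)
  moreover have "(\<Sum>c\<in>XX. w c) = (\<Sum>c\<in>{c \<in> XX. 0 < w c}. w c)"
    using finite_XX by (intro sum.mono_neutral_right) auto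
  ultimately show ?thesis by simp
qed

text \<open>A member containing \<open>Zm x\<close> shares \<open>x\<close> with
  \<open>tp x\<close>, so the two are comparable, and it cannot lie inside \<open>tp x\<close>.
  Conversely, a proper superset of \<open>tp x\<close> not containing \<open>Zm x\<close> would
  contradict \<open>tp_max\<close>.\<close>

lemma above_tp:
  assumes "x \<in> Good"
  shows "{X \<in> XX. Zm x \<subseteq> X} = above (tp x)"
proof (intro equalityI subsetI)
  fix X assume X: "X \<in> {X \<in> XX. Zm x \<subseteq> X}"
  then have "x \<in> X \<inter> tp x" using mem_Zm tp_props(2)[OF assms] by auto
  then have "X \<subseteq> tp x \<or> tp x \<subseteq> X" using X XX_lam tp_props(1)[OF assms] by (auto simp: laminar_def)
  then show "X \<in> above (tp x)" using X tp_props(3)[OF assms] by (auto simp: above_def)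
next
  fix X assume "X \<in> above (tp x)"
  then show "X \<in> {X \<in> XX. Zm x \<subseteq> X}"
    using tp_props(2)[OF assms] tp_max[OF assms, of X] by (auto simp: above_def)
qed

text \<open>Each \<open>x\<close> in \<open>K c\<close> lies in \<open>c \<inter> Zm x\<close>,
  which has fewer than \<open>t\<close> points, and by \<open>above_tp\<close> the set
  \<open>Zm x\<close> is counted by \<open>mult (above c)\<close>.\<close>

lemma w_le: "w c \<le> t * mult (above c)"
proof -
  let ?S = "{Z \<in> ZZ. {X \<in> XX. Z \<subseteq> X} = above c}"
  let ?T = "{Z \<in> ?S. card (c \<inter> Z) < t}"
  have fin: "finite ?S" "finite ?T" using finite_ZZ by (auto intro: finite_subset)
  have "K c \<subseteq> (\<Union>Z\<in>?T. c \<inter> Z)"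
  proof
    fix x assume "x \<in> K c"
    then have x: "x \<in> Good" "tp x = c" by (auto simp: K_def)
    then have "Zm x \<in> ?T" "x \<in> c \<inter> Zm x"
      using above_tp[OF x(1)] tp_props[OF x(1)] Good_in[OF x(1)] mem_Zm by auto
    then show "x \<in> (\<Union>Z\<in>?T. c \<inter> Z)" by blast
  qed
  then have "w c \<le> card (\<Union>Z\<in>?T. c \<inter> Z)"
    unfolding w_def using fin(2) finite_Z by (intro card_mono finite_UN_I) auto
  also have "\<dots> \<le> (\<Sum>Z\<in>?T. card (c \<inter> Z))"
    using fin(2) by (rule card_UN_le)
  also have "\<dots> \<le> (\<Sum>Z\<in>?T. t)" by (intro sum_mono) auto
  also have "\<dots> = t * card ?T" by simp
  also have "\<dots> \<le> t * card ?S" by (intro mult_le_mono2 card_mono fin(1)) blast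
  finally show ?thesis by (simp add: mult_def)
qed

lemma sum_mult_le: "finite PP \<Longrightarrow> (\<Sum>P\<in>PP. mult P) \<le> card ZZ"
proof -
  assume "finite PP"
  then have "(\<Sum>P\<in>PP. mult P) = card (\<Union>P\<in>PP. {Z \<in> ZZ. {X \<in> XX. Z \<subseteq> X} = P})"
    unfolding mult_def using finite_ZZ by (intro card_UN_disjoint[symmetric]) auto
  also have "\<dots> \<le> card ZZ" using finite_ZZ by (intro card_mono) auto
  finally show ?thesis .
qed

section \<open>Groups of equal logarithmic weight\<close>

abbreviation lg :: "'a set \<Rightarrow> nat" where "lg c \<equiv> floor_log (w c)"

text \<open>Within one parent the lonely sets have distinct logarithmic weights, so discarding them
  costs a geometric series. Every other set then has a sibling of the same logarithmic weight;
  this makes the forest \<open>grp b\<close> at least binary, so that at least half of it is minimal.\<close>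

definition lonely :: "'a set set" where
  "lonely = {c \<in> XX. 0 < w c \<and> (\<forall>d\<in>XX. 0 < w d \<and> above d = above c \<and> lg d = lg c \<longrightarrow> d = c)}"

definition grp :: "nat \<Rightarrow> 'a set set" where
  "grp b = {c \<in> XX - lonely. 0 < w c \<and> lg c = b}"

text \<open>Lonely sets with the same ancestors \<open>P\<close> have distinct logarithms and
  weights at most \<open>t * mult P\<close>, so their sum is at most four times this bound;
  \<open>sum_mult_le\<close> then handles the sum over \<open>P\<close>.\<close>

lemma sum_lonely: "(\<Sum>c\<in>lonely. w c) \<le> 4 * t * card ZZ"
proof -
  have fin: "finite lonely" using finite_XX by (simp add: lonely_def)
  have "(\<Sum>c\<in>lonely. w c) = (\<Sum>P\<in>above ` lonely. \<Sum>c\<in>{c \<in> lonely. above c = P}. w c)"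
    using fin by (rule sum.image_gen)
  also have "\<dots> \<le> (\<Sum>P\<in>above ` lonely. 4 * (t * mult P))"
  proof (intro sum_mono sum_le_if_inj_floor_log)
    fix P
    show "inj_on lg {c \<in> lonely. above c = P}"
      by (rule inj_onI) (auto simp: lonely_def)
    fix d assume "d \<in> {c \<in> lonely. above c = P}"
    then show "w d \<le> t * mult P" "0 < w d" using w_le[of d] by (auto simp: lonely_def)
  qed (use fin in auto)
  also have "\<dots> = 4 * t * (\<Sum>P\<in>above ` lonely. mult P)" by (simp add: sum_distrib_left mult.assoc)
  also have "\<dots> \<le> 4 * t * card ZZ" using sum_mult_le[of "above ` lonely"] fin by simp
  finally show ?thesis .
qed

lemma finite_grp: "finite (grp b)"
  using finite_XX by (simp add: grp_def)

lemma grp_partner: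
  assumes "c \<in> grp b"
  obtains d where "d \<in> grp b" "d \<noteq> c" "above d = above c"
proof -
  have c: "c \<in> XX" "c \<notin> lonely" "0 < w c" "lg c = b" using assms by (auto simp: grp_def)
  then obtain d where d: "d \<in> XX" "0 < w d" "above d = above c" "lg d = b" "d \<noteq> c"
    by (auto simp: lonely_def)
  have "d \<notin> lonely" unfolding lonely_def using c d by auto
  then show thesis using that d by (auto simp: grp_def)
qed

lemma card_grp_le: "card (grp b) \<le> 2 * card {c \<in> grp b. \<forall>d\<in>grp b. \<not> d \<subset> c}"
proof (rule card_le_twice_card_minimal)
  have sub: "grp b \<subseteq> XX" by (auto simp: grp_def)
  show "finite (grp b)" by (rule finite_grp)
  show "{} \<notin> grp b" "laminar (grp b)" using sub XX_ne laminar_subset[OF XX_lam] by auto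
  fix c assume c: "c \<in> grp b" "\<exists>d\<in>grp b. d \<subset> c"
  let ?ch = "{d \<in> grp b. d \<subset> c \<and> (\<forall>e\<in>grp b. d \<subset> e \<longrightarrow> \<not> e \<subset> c)}"
  have "finite {d \<in> grp b. d \<subset> c}" "{d \<in> grp b. d \<subset> c} \<noteq> {}" using c finite_grp by auto
  then obtain d where d: "d \<in> grp b" "d \<subset> c" and
    dmax: "\<And>e. e \<in> {d \<in> grp b. d \<subset> c} \<Longrightarrow> d \<subseteq> e \<Longrightarrow> d = e"
    using finite_has_maximal[of "{d \<in> grp b. d \<subset> c}"] by auto
  \<comment> \<open>\<open>d\<close> is a child of \<open>c\<close> within the group. Its partner
    has the same ancestors, so it is a second child.\<close>
  obtain s where s: "s \<in> grp b" "s \<noteq> d" "above s = above d" using grp_partner[OF d(1)] by blast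
  have mem_above: "e \<in> above s \<longleftrightarrow> d \<subset> e" if "e \<in> grp b" for e
    using that sub s(3) by (auto simp: above_def)
  have "d \<in> ?ch" using d dmax by blast
  moreover have "s \<in> ?ch"
  proof -
    have "c \<in> above s" using mem_above[OF c(1)] d(2) by simp
    moreover have "\<not> e \<subset> c" if e: "e \<in> grp b" "s \<subset> e" for e
    proof
      assume "e \<subset> c"
      moreover have "d \<subset> e" using e sub mem_above[OF e(1)] by (auto simp: above_def)
      ultimately show False using dmax[of e] e(1) by blast
    qed
    ultimately show ?thesis using s(1) by (simp add: above_def)
  qed
  ultimately have "{d, s} \<subseteq> ?ch" by blast
  then have "card {d, s} \<le> card ?ch" using finite_grp by (intro card_mono) auto
  then show "2 \<le> card ?ch" using s(2) by simp
qed

text \<open>\<open>E\<close> holds the exponents of the identity sizes \<open>2 ^ e\<close>: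
  distinct exponents make successive sizes at least halve, disjoint \<open>F e\<close> prevent
  double counting of points, and the bound on \<open>2 ^ Suc e\<close> limits the number of
  blocks.\<close>

lemma antichains:
  obtains E :: "nat set" and F :: "nat \<Rightarrow> 'a set set"
  where "finite E" "\<And>e. e \<in> E \<Longrightarrow> 2 ^ Suc e \<le> card XX"
    "\<And>e. e \<in> E \<Longrightarrow> F e \<subseteq> XX" "\<And>e. e \<in> E \<Longrightarrow> card (F e) = 2 ^ e"
    "\<And>e c d. e \<in> E \<Longrightarrow> c \<in> F e \<Longrightarrow> d \<in> F e \<Longrightarrow> c \<noteq> d \<Longrightarrow> c \<inter> d = {}"
    "\<And>e e'. e \<in> E \<Longrightarrow> e' \<in> E \<Longrightarrow> e \<noteq> e' \<Longrightarrow> F e \<inter> F e' = {}"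
    "card Good \<le> 4 * t * card ZZ + 16 * (\<Sum>e\<in>E. \<Sum>c\<in>F e. w c)"
proof -
  \<comment> \<open>Groups of comparable size are resolved by keeping the one of largest weight: the weights of
    the others are bounded by a geometric series.\<close>
  define bs where "bs = {b. grp b \<noteq> {}}"
  \<comment> \<open>The decrement absorbs the factor 2 of \<open>card_grp_le\<close>: a nonempty
    group has at least \<open>2 ^ ex b\<close> minimal members.\<close>
  define ex where "ex b = floor_log (card (grp b)) - 1" for b
  define E where "E = ex ` bs"
  define bt where "bt e = Max {b \<in> bs. ex b = e}" for e
  have fbs: "finite bs"
  proof -
    have "bs \<subseteq> lg ` XX" by (auto simp: bs_def grp_def)
    then show ?thesis using finite_XX by (meson finite_imageI finite_subset)
  qed
  then have "finite E" by (simp add: E_def)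
  \<comment> \<open>A nonempty group also contains a partner, so its logarithm is at least 1 and the
    subtraction in \<open>ex\<close> does not truncate.\<close>
  have card2: "2 \<le> card (grp b)" if "b \<in> bs" for b
  proof -
    obtain c where c: "c \<in> grp b" using \<open>b \<in> bs\<close> unfolding bs_def by blast
    obtain d where "d \<in> grp b" "d \<noteq> c" using grp_partner[OF c] by blast
    then have "card {c, d} \<le> card (grp b)" using c finite_grp by (intro card_mono) auto
    then show ?thesis using \<open>d \<noteq> c\<close> by simp
  qed
  have ex: "2 ^ Suc (ex b) \<le> card (grp b)" "card (grp b) < 2 ^ (ex b + 2)" if "b \<in> bs" for b
  proof -
    have "floor_log 2 \<le> floor_log (card (grp b))" using card2[OF that] by (rule floor_log_le_iff)
    then have "floor_log (card (grp b)) = Suc (ex b)" using floor_log_power[of 1] by (simp add: ex_def)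
    then show "2 ^ Suc (ex b) \<le> card (grp b)" "card (grp b) < 2 ^ (ex b + 2)"
      using floor_log_exp2_le[of "card (grp b)"] floor_log_exp2_gt[of "card (grp b)"] card2[OF that]
      by auto
  qed
  have bt: "bt e \<in> bs" "ex (bt e) = e" "\<And>b. b \<in> bs \<Longrightarrow> ex b = e \<Longrightarrow> b \<le> bt e" if "e \<in> E" for e
  proof -
    have "{b \<in> bs. ex b = e} \<noteq> {}" "finite {b \<in> bs. ex b = e}" using that fbs by (auto simp: E_def)
    then have "bt e \<in> {b \<in> bs. ex b = e}" "\<And>b. b \<in> {b \<in> bs. ex b = e} \<Longrightarrow> b \<le> bt e"
      unfolding bt_def using Max_in Max_ge by blast+
    then show "bt e \<in> bs" "ex (bt e) = e" "\<And>b. b \<in> bs \<Longrightarrow> ex b = e \<Longrightarrow> b \<le> bt e" by auto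
  qed
  have "\<exists>G. G \<subseteq> {c \<in> grp (bt e). \<forall>d\<in>grp (bt e). \<not> d \<subset> c} \<and> card G = 2 ^ e" if "e \<in> E" for e
  proof -
    have "2 ^ e \<le> card {c \<in> grp (bt e). \<forall>d\<in>grp (bt e). \<not> d \<subset> c}"
      using card_grp_le[of "bt e"] ex(1)[OF bt(1)[OF that]] bt(2)[OF that] by simp
    then obtain G where "G \<subseteq> {c \<in> grp (bt e). \<forall>d\<in>grp (bt e). \<not> d \<subset> c}" "card G = 2 ^ e"
      by (rule obtain_subset_with_card_n)
    then show ?thesis by (intro exI conjI)
  qed
  then obtain F where F: "\<And>e. e \<in> E \<Longrightarrow> F e \<subseteq> {c \<in> grp (bt e). \<forall>d\<in>grp (bt e). \<not> d \<subset> c}"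
    "\<And>e. e \<in> E \<Longrightarrow> card (F e) = 2 ^ e"
  proof -
    assume *: "\<And>F. (\<And>e. e \<in> E \<Longrightarrow> F e \<subseteq> {c \<in> grp (bt e). \<forall>d\<in>grp (bt e). \<not> d \<subset> c}) \<Longrightarrow>
      (\<And>e. e \<in> E \<Longrightarrow> card (F e) = 2 ^ e) \<Longrightarrow> thesis"
      and ex: "\<And>e. e \<in> E \<Longrightarrow>
        \<exists>G. G \<subseteq> {c \<in> grp (bt e). \<forall>d\<in>grp (bt e). \<not> d \<subset> c} \<and> card G = 2 ^ e"
    show thesis
      by (rule *[of "\<lambda>e. SOME G. G \<subseteq> {c \<in> grp (bt e). \<forall>d\<in>grp (bt e). \<not> d \<subset> c} \<and> card G = 2 ^ e"])
        (use someI_ex[OF ex] in simp_all)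
  qed
  have Fg: "F e \<subseteq> grp (bt e)" if "e \<in> E" for e using F(1)[OF that] by auto
  have grpXX: "grp b \<subseteq> XX" for b by (auto simp: grp_def)
  show thesis
  proof (rule that[of E F])
    show "2 ^ Suc e \<le> card XX" if "e \<in> E" for e
      using ex(1)[OF bt(1)[OF that]] bt(2)[OF that] card_mono[OF finite_XX grpXX] by (metis order_trans)
    show "F e \<subseteq> XX" if "e \<in> E" for e using Fg[OF that] grpXX by blast
    show "c \<inter> d = {}" if "e \<in> E" "c \<in> F e" "d \<in> F e" "c \<noteq> d" for e c d
    proof -
      have cd: "c \<in> grp (bt e)" "d \<in> grp (bt e)" "\<not> d \<subset> c" "\<not> c \<subset> d" using F(1)[OF that(1)] that by auto
      then have "c \<in> XX" "d \<in> XX" using grpXX by auto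
      then show ?thesis using XX_lam cd that(4) unfolding laminar_def by blast
    qed
    show "F e \<inter> F e' = {}" if "e \<in> E" "e' \<in> E" "e \<noteq> e'" for e e'
    proof -
      have "bt e \<noteq> bt e'" using bt(2) that by metis
      then have "grp (bt e) \<inter> grp (bt e') = {}" by (auto simp: grp_def)
      then show ?thesis using Fg[OF that(1)] Fg[OF that(2)] by blast
    qed
    have "card Good = (\<Sum>c\<in>{c \<in> XX. 0 < w c}. w c)" by (rule sum_w)
    also have "\<dots> = (\<Sum>c\<in>lonely \<union> (\<Union>b\<in>bs. grp b). w c)"
      by (rule sum.cong) (auto simp: lonely_def grp_def bs_def)
    also have "\<dots> \<le> (\<Sum>c\<in>lonely. w c) + (\<Sum>c\<in>(\<Union>b\<in>bs. grp b). w c)"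
      by (rule sum_Un_nat[THEN eq_refl, THEN order_trans]) 
        (use finite_XX fbs finite_grp in \<open>auto simp: lonely_def\<close>)
    also have "(\<Sum>c\<in>(\<Union>b\<in>bs. grp b). w c) = (\<Sum>b\<in>bs. \<Sum>c\<in>grp b. w c)"
      using fbs finite_grp by (intro sum.UNION_disjoint) (auto simp: grp_def)
    also have "\<dots> \<le> (\<Sum>b\<in>bs. 2 ^ (ex b + 3) * 2 ^ b)"
    proof (rule sum_mono)
      fix b assume b: "b \<in> bs"
      have "w c \<le> 2 * 2 ^ b" if "c \<in> grp b" for c
        using floor_log_exp2_gt[of "w c"] that by (auto simp: grp_def)
      then have "(\<Sum>c\<in>grp b. w c) \<le> card (grp b) * (2 * 2 ^ b)"
        using sum_bounded_above[of "grp b" w] by simp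
      also have "\<dots> \<le> 2 ^ (ex b + 2) * (2 * 2 ^ b)" using ex(2)[OF b] by simp
      finally show "(\<Sum>c\<in>grp b. w c) \<le> 2 ^ (ex b + 3) * 2 ^ b" by (simp add: power_add)
    qed
    also have "\<dots> = (\<Sum>e\<in>E. \<Sum>b\<in>{b \<in> bs. ex b = e}. 2 ^ (ex b + 3) * 2 ^ b)"
      unfolding E_def using fbs by (rule sum.image_gen)
    \<comment> \<open>For fixed \<open>e\<close> the powers \<open>2 ^ b\<close> sum to at most
      \<open>2 * 2 ^ bt e\<close>, and each of the \<open>2 ^ e\<close> members of
      \<open>F e\<close> weighs at least \<open>2 ^ bt e\<close>; with the factor 8 this gives
      16.\<close>
    also have "\<dots> \<le> (\<Sum>e\<in>E. 16 * (\<Sum>c\<in>F e. w c))"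
    proof (rule sum_mono)
      fix e assume e: "e \<in> E"
      have "(\<Sum>b\<in>{b \<in> bs. ex b = e}. 2 ^ (ex b + 3) * 2 ^ b)
          = 8 * 2 ^ e * (\<Sum>b\<in>{b \<in> bs. ex b = e}. 2 ^ b :: nat)"
        by (simp add: sum_distrib_left power_add mult_ac)
      also have "(\<Sum>b\<in>{b \<in> bs. ex b = e}. 2 ^ b :: nat) \<le> 2 * 2 ^ bt e"
        using fbs bt(3)[OF e] by (intro sum_power2_le) auto
      also have "8 * 2 ^ e * (2 * 2 ^ bt e) = 16 * (card (F e) * 2 ^ bt e)" using F(2)[OF e] by simp
      also have "card (F e) * 2 ^ bt e \<le> (\<Sum>c\<in>F e. w c)"
      proof -
        have "2 ^ bt e \<le> w c" if "c \<in> F e" for c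
          using Fg[OF e] that floor_log_exp2_le[of "w c"] by (auto simp: grp_def)
        then show ?thesis using sum_bounded_below[of "F e" "2 ^ bt e" w] by simp
      qed
      finally show "(\<Sum>b\<in>{b \<in> bs. ex b = e}. 2 ^ (ex b + 3) * 2 ^ b) \<le> 16 * (\<Sum>c\<in>F e. w c)"
        by simp
    qed
    also have "\<dots> = 16 * (\<Sum>e\<in>E. \<Sum>c\<in>F e. w c)" by (simp add: sum_distrib_left)
    finally show "card Good \<le> 4 * t * card ZZ + 16 * (\<Sum>e\<in>E. \<Sum>c\<in>F e. w c)"
      using sum_lonely by linarith
  qed (use \<open>finite E\<close> F(2) in auto)
qed

end

section \<open>Rows of a matrix avoiding \<open>Q3 t\<close>\<close>

text \<open>\<open>submatrix\<close> reads its columns through \<open>pick J\<close>, in increasing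
  order; the bijection turns any other enumeration of \<open>J\<close> into a column
  permutation.\<close>

lemma bij_betw_pick:
  assumes "finite J"
  shows "bij_betw (pick J) {..<card J} J"
proof -
  have "J \<subseteq> pick J ` {..<card J}"
  proof
    fix i assume i: "i \<in> J"
    then have "card {a \<in> J. a < i} < card J" using assms by (intro psubset_card_mono) auto
    then show "i \<in> pick J ` {..<card J}"
      using pick_card_in_set[OF i] by (intro image_eqI[of _ _ "card {a \<in> J. a < i}"]) simp_all
  qed
  moreover have "pick J ` {..<card J} \<subseteq> J" using pick_in_set_le by auto
  ultimately have *: "pick J ` {..<card J} = J" by blast
  then have "inj_on (pick J) {..<card J}" by (intro eq_card_imp_inj_on) auto
  with * show ?thesis by (simp add: bij_betw_def)
qed

lemma pick_pair:
  assumes "r < s"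
  shows "pick {r, s} 0 = r" "pick {r, s} (Suc 0) = s"
proof -
  show 0: "pick {r, s} 0 = r" using assms by (auto intro!: Least_equality)
  show "pick {r, s} (Suc 0) = s"
    unfolding pick.simps(2) 0 using assms by (auto intro!: Least_equality)
qed

lemma dim_Q3 [simp]: "dim_row (Q3 t) = 2" "dim_col (Q3 t) = 2 * t + 2"
  by (simp_all add: Q3_def mat_of_cols_list_def)

lemma Q3_index:
  assumes "j < 2 * t + 2"
  shows "Q3 t $$ (0, j) = (if 1 \<le> j \<and> j \<le> t \<or> j = 2 * t + 1 then 1 else 0)"
    "Q3 t $$ (Suc 0, j) = (if t < j then 1 else 0)"
  using assms
  by (auto simp: Q3_def mat_of_cols_list_def nth_append nth_Cons')

lemma is_configuration_Q3I:
  assumes rs: "r < s" "s < dim_row A"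
    and a: "a < dim_col A" "A $$ (r, a) = 0" "A $$ (s, a) = 0"
    and d: "d < dim_col A" "A $$ (r, d) = 1" "A $$ (s, d) = 1"
    and B: "t \<le> card {c \<in> {..<dim_col A}. A $$ (r, c) = 1 \<and> A $$ (s, c) = 0}"
    and B': "t \<le> card {c \<in> {..<dim_col A}. A $$ (r, c) = 0 \<and> A $$ (s, c) = 1}"
  shows "is_configuration (Q3 t) A"
proof -
  obtain Y where Y: "Y \<subseteq> {c \<in> {..<dim_col A}. A $$ (r, c) = 1 \<and> A $$ (s, c) = 0}" "card Y = t" "finite Y"
    using B by (rule obtain_subset_with_card_n)
  obtain Y' where Y': "Y' \<subseteq> {c \<in> {..<dim_col A}. A $$ (r, c) = 0 \<and> A $$ (s, c) = 1}" "card Y' = t" "finite Y'"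
    using B' by (rule obtain_subset_with_card_n)
  obtain f where f: "bij_betw f {..<t} Y"
    using ex_bij_betw_nat_finite[OF Y(3)] Y(2) by (auto simp: atLeast0LessThan)
  obtain f' where f': "bij_betw f' {..<t} Y'"
    using ex_bij_betw_nat_finite[OF Y'(3)] Y'(2) by (auto simp: atLeast0LessThan)
  have fY: "f i < dim_col A" "A $$ (r, f i) = 1" "A $$ (s, f i) = 0" if "i < t" for i
    using bij_betwE[OF f] Y(1) that by auto
  have fY': "f' i < dim_col A" "A $$ (r, f' i) = 0" "A $$ (s, f' i) = 1" if "i < t" for i
    using bij_betwE[OF f'] Y'(1) that by auto
  \<comment> \<open>The chosen columns in the order of the columns of \<open>Q3 t\<close>: position
    0, then 1 to \<open>t\<close>, \<open>t + 1\<close> to \<open>2 * t\<close>, and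
    \<open>2 * t + 1\<close>.\<close>
  define h where "h j = (if j = 0 then a else if j \<le> t then f (j - 1)
    else if j \<le> 2 * t then f' (j - t - 1) else d)" for j
  have h: "h j < dim_col A" "A $$ (r, h j) = Q3 t $$ (0, j)" "A $$ (s, h j) = Q3 t $$ (Suc 0, j)"
    if "j < 2 * t + 2" for j
    using that a d fY fY' by (auto simp: h_def Q3_index)
  \<comment> \<open>Different blocks of \<open>Q3 t\<close> have different columns, so equal values
    of \<open>h\<close> come from one block, where \<open>f\<close> or \<open>f'\<close> is
    injective.\<close>
  have inj: "inj_on h {..<2 * t + 2}"
  proof (rule inj_onI)
    fix i j assume ij: "i \<in> {..<2 * t + 2}" "j \<in> {..<2 * t + 2}" "h i = h j"
    have q: "Q3 t $$ (0, i) = Q3 t $$ (0, j)" "Q3 t $$ (Suc 0, i) = Q3 t $$ (Suc 0, j)"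
      using h(2,3)[of i] h(2,3)[of j] ij by auto
    have f_eq: "i = j" if "f (i - 1) = f (j - 1)" "1 \<le> i" "i \<le> t" "1 \<le> j" "j \<le> t"
    proof -
      have "i - 1 = j - 1"
        using inj_onD[OF bij_betw_imp_inj_on[OF f] that(1)] that(2-) by simp
      then show ?thesis using that by linarith
    qed
    have f'_eq: "i = j"
      if "f' (i - t - 1) = f' (j - t - 1)" "t < i" "i \<le> 2 * t" "t < j" "j \<le> 2 * t"
    proof -
      have "i - t - 1 = j - t - 1"
        using inj_onD[OF bij_betw_imp_inj_on[OF f'] that(1)] that(2-) by simp
      then show ?thesis using that by linarith
    qed
    have lt: "i < 2 * t + 2" "j < 2 * t + 2" using ij by simp_all
    have q0: "1 \<le> i \<and> i \<le> t \<or> i = 2 * t + 1 \<longleftrightarrow> 1 \<le> j \<and> j \<le> t \<or> j = 2 * t + 1"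
      using q(1) unfolding Q3_index(1)[OF lt(1)] Q3_index(1)[OF lt(2)] by (metis zero_neq_one)
    have q1: "t < i \<longleftrightarrow> t < j"
      using q(2) unfolding Q3_index(2)[OF lt(1)] Q3_index(2)[OF lt(2)] by (metis zero_neq_one)
    have "i = j \<or> 1 \<le> i \<and> i \<le> t \<and> 1 \<le> j \<and> j \<le> t \<or> t < i \<and> i \<le> 2 * t \<and> t < j \<and> j \<le> 2 * t"
      using lt q0 q1 by presburger
    then consider "i = j" | "1 \<le> i" "i \<le> t" "1 \<le> j" "j \<le> t" | "t < i" "i \<le> 2 * t" "t < j" "j \<le> 2 * t"
      by blast
    then show "i = j"
    proof cases
      case 2
      have "h i = f (i - 1)" "h j = f (j - 1)" using 2 by (simp_all add: h_def)
      then have "f (i - 1) = f (j - 1)" using ij(3) by argo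
      then show ?thesis using 2 by (rule f_eq)
    next
      case 3
      have "h i = f' (i - t - 1)" "h j = f' (j - t - 1)" using 3 by (simp_all add: h_def)
      then have "f' (i - t - 1) = f' (j - t - 1)" using ij(3) by argo
      then show ?thesis using 3 by (rule f'_eq)
    qed
  qed
  define J where "J = h ` {..<2 * t + 2}"
  have hbij: "bij_betw h {..<2 * t + 2} J" using inj by (simp add: J_def bij_betw_def)
  have J: "J \<subseteq> {..<dim_col A}" "card J = 2 * t + 2" "finite J"
    using h(1) inj by (auto simp: J_def card_image)
  \<comment> \<open>\<open>q j\<close> is the position at which \<open>h\<close> lists the
    \<open>j\<close>-th column of \<open>J\<close> in increasing order; outside the range it is the
    identity, as \<open>permutes\<close> demands.\<close>
  define q where "q j = (if j < 2 * t + 2 then inv_into {..<2 * t + 2} h (pick J j) else j)" for j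
  have pick: "bij_betw (pick J) {..<2 * t + 2} J" using bij_betw_pick[OF J(3)] J(2) by simp
  have "bij_betw (inv_into {..<2 * t + 2} h \<circ> pick J) {..<2 * t + 2} {..<2 * t + 2}"
    using pick bij_betw_inv_into[OF hbij] by (rule bij_betw_trans)
  moreover have "bij_betw (inv_into {..<2 * t + 2} h \<circ> pick J) {..<2 * t + 2} {..<2 * t + 2}
      = bij_betw q {..<2 * t + 2} {..<2 * t + 2}"
    by (rule bij_betw_cong) (simp add: q_def)
  ultimately have qperm: "q permutes {..<2 * t + 2}"
    by (intro bij_imp_permutes) (auto simp: q_def)
  have hq: "h (q j) = pick J j" if "j < 2 * t + 2" for j
    using that bij_betwE[OF pick] f_inv_into_f[of "pick J j" h "{..<2 * t + 2}"]
    by (auto simp: q_def J_def)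
  have qlt: "q j < 2 * t + 2" if "j < 2 * t + 2" for j
    using permutes_in_image[OF qperm, of j] that by simp
  have rows: "{i. i < dim_row A \<and> i \<in> {r, s}} = {r, s}" using rs by auto
  have cols: "{j. j < dim_col A \<and> j \<in> J} = J" using J(1) by auto
  have sub: "submatrix A {r, s} J = mat (dim_row (Q3 t)) (dim_col (Q3 t)) (\<lambda>(i, j). Q3 t $$ (id i, q j))"
  proof (rule eq_matI)
    fix i j assume "i < dim_row (mat (dim_row (Q3 t)) (dim_col (Q3 t)) (\<lambda>(i, j). Q3 t $$ (id i, q j)))"
      "j < dim_col (mat (dim_row (Q3 t)) (dim_col (Q3 t)) (\<lambda>(i, j). Q3 t $$ (id i, q j)))"
    then have ij: "i < 2" "j < 2 * t + 2" by auto
    then have "submatrix A {r, s} J $$ (i, j) = A $$ (pick {r, s} i, pick J j)"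
      using rs J by (intro submatrix_index) (simp_all only: rows cols, simp_all)
    also have "\<dots> = Q3 t $$ (i, q j)"
      using ij(1) h(2,3)[OF qlt[OF ij(2)]] hq[OF ij(2)] pick_pair[OF rs(1)]
      by (cases i) (auto simp: less_Suc_eq_0_disj numeral_2_eq_2)
    finally show "submatrix A {r, s} J $$ (i, j)
        = mat (dim_row (Q3 t)) (dim_col (Q3 t)) (\<lambda>(i, j). Q3 t $$ (id i, q j)) $$ (i, j)"
      using ij by simp
  qed (use rs J in \<open>simp_all only: dim_submatrix rows cols dim_row_mat dim_col_mat dim_Q3, simp_all\<close>)
  show ?thesis
    unfolding is_configuration_def
  proof (intro exI conjI)
    show "{r, s} \<subseteq> {..<dim_row A}" using rs by simp
    show "J \<subseteq> {..<dim_col A}" by (rule J(1))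
    show "id permutes {..<dim_row (Q3 t)}" by (rule permutes_id)
    show "q permutes {..<dim_col (Q3 t)}" using qperm by simp
    show "submatrix A {r, s} J = mat (dim_row (Q3 t)) (dim_col (Q3 t)) (\<lambda>(i, j). Q3 t $$ (id i, q j))"
      by (rule sub)
  qed
qed

lemma is_configuration_submatrix:
  assumes "I \<subseteq> {..<dim_row A}" "J \<subseteq> {..<dim_col A}"
  shows "is_configuration (submatrix A I J) A"
proof -
  have "submatrix A I J = mat (dim_row (submatrix A I J)) (dim_col (submatrix A I J))
      (\<lambda>(i, j). submatrix A I J $$ (id i, id j))"
    by (rule eq_matI) auto
  then show ?thesis
    unfolding is_configuration_def using assms permutes_id by blast
qed

definition ones :: "nat mat \<Rightarrow> nat \<Rightarrow> nat set" where
  "ones A r = {c. c < dim_col A \<and> A $$ (r, c) = 1}"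

definition zeros :: "nat mat \<Rightarrow> nat \<Rightarrow> nat set" where
  "zeros A r = {c. c < dim_col A \<and> A $$ (r, c) = 0}"

lemma simple_matrix_entry:
  assumes "simple_matrix A" "r < dim_row A" "c < dim_col A"
  shows "A $$ (r, c) = 0 \<or> A $$ (r, c) = 1"
proof -
  have "A $$ (r, c) \<in> elements_mat A" using assms by (intro elements_matI) auto
  then show ?thesis using assms(1) by (auto simp: simple_matrix_def)
qed

lemma zeros_eq:
  assumes "simple_matrix A" "r < dim_row A"
  shows "zeros A r = {..<dim_col A} - ones A r" "ones A r = {..<dim_col A} - zeros A r"
  using simple_matrix_entry[OF assms] unfolding zeros_def ones_def by force+

text \<open>If all alternatives fail, the two rows have a common 0, a common 1 and \<open>t\<close>
  columns of each mixed kind, a copy of \<open>Q3 t\<close>. For \<open>r = s\<close> the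
  differences are empty.\<close>

lemma Avoid_Q3_rows:
  assumes "A \<in> Avoid m (Q3 t)" "0 < t" "r < m" "s < m"
  shows "ones A r \<inter> ones A s = {} \<or> zeros A r \<inter> zeros A s = {} \<or>
    card (ones A r - ones A s) < t \<or> card (ones A s - ones A r) < t"
proof -
  have A: "dim_row A = m" "simple_matrix A" "\<not> is_configuration (Q3 t) A"
    using assms(1) by (auto simp: Avoid_def)
  have less: "ones A r \<inter> ones A s = {} \<or> zeros A r \<inter> zeros A s = {} \<or>
      card (ones A r - ones A s) < t \<or> card (ones A s - ones A r) < t"
    if "r < s" "s < m" for r s
  proof (rule ccontr)
    assume H: "\<not> (ones A r \<inter> ones A s = {} \<or> zeros A r \<inter> zeros A s = {} \<or>
      card (ones A r - ones A s) < t \<or> card (ones A s - ones A r) < t)"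
    then obtain a d where a: "a \<in> zeros A r \<inter> zeros A s" and d: "d \<in> ones A r \<inter> ones A s" by blast
    have "ones A r - ones A s = {c \<in> {..<dim_col A}. A $$ (r, c) = 1 \<and> A $$ (s, c) = 0}"
      "ones A s - ones A r = {c \<in> {..<dim_col A}. A $$ (r, c) = 0 \<and> A $$ (s, c) = 1}"
      using simple_matrix_entry[OF A(2), of r] simple_matrix_entry[OF A(2), of s] A(1) that
      unfolding ones_def by force+
    then have "is_configuration (Q3 t) A"
      using H a d that A(1)
      by (intro is_configuration_Q3I[of r s A a d]) (auto simp: zeros_def ones_def)
    with A(3) show False ..
  qed
  show ?thesis
  proof (rule linorder_cases[of r s])
    assume "r = s"
    then show ?thesis using assms(2) by simp
  qed (use less[of r s] less[of s r] assms in blast)+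
qed

section \<open>Identity blocks\<close>

text \<open>What the theorem asks of one configuration with rows \<open>R\<close> and columns
  \<open>C\<close>. The rows \<open>\<rho>\<close> carrying the identity matrix may lie outside
  \<open>R\<close>.\<close>

definition id_block ::
  "nat \<Rightarrow> nat mat \<Rightarrow> nat \<Rightarrow> nat set \<Rightarrow> nat set \<Rightarrow> (nat \<Rightarrow> nat) \<Rightarrow> bool" where
  "id_block t A k R C \<rho> \<longleftrightarrow>
     R \<subseteq> {..<dim_row A} \<and> C \<subseteq> {..<dim_col A} \<and>
     inj_on \<rho> {..<k} \<and> \<rho> ` {..<k} \<subseteq> {..<dim_row A} \<and>
     (\<forall>c\<in>C. \<exists>i<k. restricted_col A k \<rho> c = col (1\<^sub>m k) i) \<and>
     (\<forall>i<k.
        (\<forall>r\<in>R. \<not> dense_row t A (id_class A C k \<rho> i) r) \<and>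
        (\<forall>c\<in>id_class A C k \<rho> i. \<exists>r\<in>R. identified_by t A (id_class A C k \<rho> i) c r))"

lemma restricted_col_eq_iff:
  assumes "i < k"
  shows "restricted_col A k \<rho> c = col (1\<^sub>m k) i \<longleftrightarrow>
    (\<forall>l<k. A $$ (\<rho> l, c) = (if l = i then 1 else 0))"
  using assms by (auto simp: restricted_col_def vec_eq_iff)

text \<open>The identity pattern forces the class of index \<open>i\<close> to be exactly
  \<open>K i\<close>. A row is not dense if it is zero throughout \<open>K i\<close> or has fewer
  than \<open>t\<close> zeros there.\<close>

lemma id_blockI:
  assumes R: "R \<subseteq> {..<dim_row A}" and C: "(\<Union>i<k. K i) \<subseteq> {..<dim_col A}"
    and \<rho>: "\<And>l. l < k \<Longrightarrow> \<rho> l < dim_row A"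
    and id: "\<And>i l c. i < k \<Longrightarrow> l < k \<Longrightarrow> c \<in> K i \<Longrightarrow> A $$ (\<rho> l, c) = (if l = i then 1 else 0)"
    and inj: "inj_on \<rho> {..<k}"
    and nondense: "\<And>i r. i < k \<Longrightarrow> r \<in> R \<Longrightarrow>
      K i \<subseteq> zeros A r \<or> card (K i \<inter> zeros A r) < t"
    and ident: "\<And>i c. i < k \<Longrightarrow> c \<in> K i \<Longrightarrow>
      \<exists>r\<in>R. c \<in> zeros A r \<and> card (K i \<inter> zeros A r) < t"
  shows "id_block t A k R (\<Union>i<k. K i) \<rho>"
proof -
  let ?C = "\<Union>i<k. K i"
  have restr: "restricted_col A k \<rho> c = col (1\<^sub>m k) i" if "i < k" "c \<in> K i" for i c
    unfolding restricted_col_eq_iff[OF that(1)] using id that by blast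
  have id_class_eq: "id_class A ?C k \<rho> i = K i" if i: "i < k" for i
  proof -
    have "c \<in> K i" if "i' < k" "c \<in> K i'" "restricted_col A k \<rho> c = col (1\<^sub>m k) i" for c i'
    proof -
      have "A $$ (\<rho> i, c) = 1" using that(3) i unfolding restricted_col_eq_iff[OF i] by simp
      then have "i' = i" using id[OF that(1) i that(2)] by (metis zero_neq_one)
      then show ?thesis using that by simp
    qed
    then show ?thesis using restr i unfolding id_class_def by blast
  qed
  have zero_set: "{c \<in> K i. A $$ (r, c) = 0} = K i \<inter> zeros A r" if "i < k" for i r
    using that C by (auto simp: zeros_def)
  have "\<not> dense_row t A (K i) r" if "i < k" "r \<in> R" for i r
    using nondense[OF that] unfolding dense_row_def zero_set[OF that(1)]
    by (auto simp: zeros_def subset_iff)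
  moreover have "\<exists>r\<in>R. identified_by t A (K i) c r" if ic: "i < k" "c \<in> K i" for i c
  proof -
    obtain r where "r \<in> R" "c \<in> zeros A r" "card (K i \<inter> zeros A r) < t"
      using ident[OF ic] by blast
    then show ?thesis
      unfolding identified_by_def sparse_row_def zero_set[OF ic(1)]
      using ic by (intro bexI[of _ r]) (auto simp: zeros_def)
  qed
  ultimately show ?thesis
    unfolding id_block_def using R C \<rho> inj restr by (auto simp: id_class_eq)
qed

lemma Avoid_Q3_id_blocks:
  assumes t: "2 \<le> t" and A: "A \<in> Avoid m (Q3 t)" and m: "1 \<le> m"
    and large: "14 * t * m \<le> dim_col A"
  obtains E :: "nat set" and R C :: "nat \<Rightarrow> nat set" and \<rho> :: "nat \<Rightarrow> nat \<Rightarrow> nat"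
  where "finite E" "\<And>e. e \<in> E \<Longrightarrow> 2 ^ Suc e \<le> m"
    "\<And>e. e \<in> E \<Longrightarrow> id_block t A (2 ^ e) (R e) (C e) (\<rho> e)"
    "dim_col A \<le> 32 * (\<Sum>e\<in>E. card (C e))" "(\<Sum>e\<in>E. card (C e)) \<le> dim_col A"
proof -

  \<comment> \<open>Light and heavy rows\<close>
  have dimr: "dim_row A = m" and simple: "simple_matrix A" using A by (auto simp: Avoid_def)
  define n where "n = dim_col A"
  define Sx where "Sx = {r. r < m \<and> 2 * card (ones A r) \<le> n}"
  define Sz where "Sz = {r. r < m \<and> n < 2 * card (ones A r)}"
  have fin_ones: "finite (ones A r)" "finite (zeros A r)" for r by (auto simp: ones_def zeros_def)
  have finS: "finite Sx" "finite Sz" by (auto simp: Sx_def Sz_def)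
  have cardS: "card Sx + card Sz = m"
  proof -
    have "card Sx + card Sz = card (Sx \<union> Sz)"
      using finS by (intro card_Un_disjoint[symmetric]) (auto simp: Sx_def Sz_def)
    also have "Sx \<union> Sz = {..<m}" by (auto simp: Sx_def Sz_def)
    finally show ?thesis by simp
  qed
  have compl: "card (ones A r) + card (zeros A r) = n" if "r < m" for r
  proof -
    have "card (ones A r) + card (zeros A r) = card (ones A r \<union> zeros A r)"
      using fin_ones by (intro card_Un_disjoint[symmetric]) (auto simp: ones_def zeros_def)
    also have "ones A r \<union> zeros A r = {..<n}"
      using zeros_eq(1)[OF simple] that dimr by (auto simp: n_def ones_def)
    finally show ?thesis by simp
  qed
  have rows: "ones A r \<inter> ones A s = {} \<or> zeros A r \<inter> zeros A s = {} \<or>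
    card (ones A r - ones A s) < t \<or> card (ones A s - ones A r) < t" if "r < m" "s < m" for r s
    using Avoid_Q3_rows[OF A _ that] t by simp
  have diff_zeros: "ones A r - ones A s = zeros A s - zeros A r" if "r < m" "s < m" for r s
    using zeros_eq[OF simple] that dimr by blast

  \<comment> \<open>If the zero sets are disjoint, the supports cover all columns; each is at most
    half of them, so the supports are disjoint.\<close>
  have xx: "ones A r \<inter> ones A s = {} \<or> card (ones A r - ones A s) < t \<or> card (ones A s - ones A r) < t"
    if "r \<in> Sx" "s \<in> Sx" for r s
  proof (cases "zeros A r \<inter> zeros A s = {}")
    case True
    have rs: "r < m" "s < m" using that by (auto simp: Sx_def)
    have "ones A r \<union> ones A s = {..<n}"
      using True zeros_eq(2)[OF simple] rs dimr zeros_eq(1)[OF simple] by (auto simp: n_def ones_def)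
    then have "n \<le> card (ones A r) + card (ones A s) - card (ones A r \<inter> ones A s)"
      using card_Un_Int[OF fin_ones(1) fin_ones(1), of r s] by simp
    moreover have "card (ones A r \<inter> ones A s) \<le> card (ones A r)" using fin_ones by (simp add: card_mono)
    ultimately have "card (ones A r \<inter> ones A s) = 0" using that by (auto simp: Sx_def)
    then show ?thesis using fin_ones by simp
  qed (use rows that in \<open>auto simp: Sx_def\<close>)
  \<comment> \<open>Two supports of more than half of the columns meet, and differences of zero sets
    are differences of supports in reverse order.\<close>
  have zz: "zeros A r \<inter> zeros A s = {} \<or> card (zeros A r - zeros A s) < t \<or> card (zeros A s - zeros A r) < t"
    if "r \<in> Sz" "s \<in> Sz" for r s
  proof -
    have rs: "r < m" "s < m" using that by (auto simp: Sz_def)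
    have "ones A r \<inter> ones A s \<noteq> {}"
    proof
      assume "ones A r \<inter> ones A s = {}"
      then have "card (ones A r) + card (ones A s) = card (ones A r \<union> ones A s)"
        using fin_ones by (simp add: card_Un_disjoint)
      also have "\<dots> \<le> card {..<n}" by (intro card_mono) (auto simp: ones_def n_def)
      finally show False using that by (auto simp: Sz_def)
    qed
    then show ?thesis using rows[OF rs] diff_zeros[OF rs] diff_zeros[OF rs(2,1)] by auto
  qed
  \<comment> \<open>\<open>ones A r \<inter> zeros A s\<close> equals
    \<open>ones A r - ones A s\<close>, the smaller of the two differences because a light support
    is no larger than a heavy one.\<close>
  have xz: "ones A r \<subseteq> zeros A s \<or> zeros A s \<subseteq> ones A r \<or> card (ones A r \<inter> zeros A s) < t"
    if "r \<in> Sx" "s \<in> Sz" for r s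
  proof -
    have rs: "r < m" "s < m" using that by (auto simp: Sx_def Sz_def)
    have sub: "ones A r \<subseteq> {..<n}" "ones A s \<subseteq> {..<n}" by (auto simp: ones_def n_def)
    note z = zeros_eq(1)[OF simple, unfolded dimr, folded n_def]
    consider "ones A r \<inter> ones A s = {}" | "zeros A r \<inter> zeros A s = {}"
      | "card (ones A r - ones A s) < t" | "card (ones A s - ones A r) < t"
      using rows[OF rs] by blast
    then show ?thesis
    proof cases
      case 1
      then show ?thesis using sub z[OF rs(2)] by blast
    next
      case 2
      then have "zeros A s \<subseteq> ones A r" using z[OF rs(1)] z[OF rs(2)] by blast
      then show ?thesis by blast
    next
      case 3
      have "ones A r \<inter> zeros A s = ones A r - ones A s" using sub z[OF rs(2)] by blast
      then show ?thesis using 3 by simp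
    next
      case 4
      have "card (ones A r - ones A s) \<le> card (ones A s - ones A r)"
      proof -
        have "card (ones A r) \<le> card (ones A s)" using that by (auto simp: Sx_def Sz_def)
        then show ?thesis using fin_ones by (simp add: card_Diff_subset_Int Int_commute)
      qed
      moreover have "ones A r \<inter> zeros A s = ones A r - ones A s" using sub z[OF rs(2)] by blast
      ultimately show ?thesis using 4 by simp
    qed
  qed

  \<comment> \<open>Deletion of columns\<close>
  have "\<exists>D\<subseteq>\<Union>(ones A ` Sx). card D \<le> t * card Sx \<and> laminar ((\<lambda>r. ones A r - D) ` Sx)"
    by (rule laminar_deletion) (rule finS fin_ones xx | assumption)+
  then obtain Dx where Dx: "card Dx \<le> t * card Sx" "laminar ((\<lambda>r. ones A r - Dx) ` Sx)" "Dx \<subseteq> \<Union>(ones A ` Sx)"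
    by blast
  have "\<exists>D\<subseteq>\<Union>(zeros A ` Sz). card D \<le> t * card Sz \<and> laminar ((\<lambda>r. zeros A r - D) ` Sz)"
    by (rule laminar_deletion) (rule finS fin_ones zz | assumption)+
  then obtain Dz where Dz: "card Dz \<le> t * card Sz" "laminar ((\<lambda>r. zeros A r - Dz) ` Sz)" "Dz \<subseteq> \<Union>(zeros A ` Sz)"
    by blast
  define D where "D = Dx \<union> Dz"
  define X where "X r = ones A r - D" for r
  define Z where "Z r = zeros A r - D" for r
  define Om where "Om = {..<n} - D"
  define XX where "XX = X ` Sx - {{}}"
  define ZZ where "ZZ = Z ` Sz"
  have cardD: "card D \<le> t * m"
  proof -
    have "card D \<le> card Dx + card Dz" unfolding D_def by (rule card_Un_le)
    also have "\<dots> \<le> t * (card Sx + card Sz)" using Dx(1) Dz(1) by (simp add: algebra_simps)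
    finally show ?thesis by (simp add: cardS)
  qed
  have X_eq: "X ` Sx = (\<lambda>Y. Y - Dz) ` ((\<lambda>r. ones A r - Dx) ` Sx)"
    and Z_eq: "Z ` Sz = (\<lambda>Y. Y - Dx) ` ((\<lambda>r. zeros A r - Dz) ` Sz)"
    by (auto simp: X_def Z_def D_def image_image Diff_eq Un_commute inf_assoc intro!: image_cong)
  interpret crossing_laminar Om XX ZZ t
  proof
    show "finite Om" by (simp add: Om_def)
    show "XX \<subseteq> Pow Om" "ZZ \<subseteq> Pow Om"
      by (auto simp: XX_def ZZ_def X_def Z_def Om_def ones_def zeros_def n_def)
    show "{} \<notin> XX" by (simp add: XX_def)
    have "laminar (X ` Sx)" unfolding X_eq by (rule laminar_restrict[OF Dx(2)])
    then show "laminar XX" by (rule laminar_subset) (simp add: XX_def)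
    show "laminar ZZ" unfolding ZZ_def Z_eq by (rule laminar_restrict[OF Dz(2)])
  next
    fix U V assume "U \<in> XX" "V \<in> ZZ"
    then obtain r s where rs: "r \<in> Sx" "s \<in> Sz" "U = X r" "V = Z s" by (auto simp: XX_def ZZ_def)
    have "card (U \<inter> V) \<le> card (ones A r \<inter> zeros A s)"
      using fin_ones rs by (intro card_mono) (auto simp: X_def Z_def)
    then show "U \<subseteq> V \<or> V \<subseteq> U \<or> card (U \<inter> V) < t"
      using xz[OF rs(1,2)] rs(3,4) by (auto simp: X_def Z_def)
  next
    \<comment> \<open>Points in the same sets agree in every row, so simplicity makes them equal. A
      light row whose trimmed support is empty is 0 at both.\<close>
    fix x y assume xy: "x \<in> Om" "y \<in> Om" "\<And>U. U \<in> XX \<Longrightarrow> x \<in> U \<longleftrightarrow> y \<in> U"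
      "\<And>V. V \<in> ZZ \<Longrightarrow> x \<in> V \<longleftrightarrow> y \<in> V"
    have lt: "x < dim_col A" "y < dim_col A" using xy by (auto simp: Om_def n_def)
    have "A $$ (r, x) = A $$ (r, y)" if r: "r < m" for r
    proof -
      have e: "A $$ (r, x) = 0 \<or> A $$ (r, x) = 1" "A $$ (r, y) = 0 \<or> A $$ (r, y) = 1"
        using simple_matrix_entry[OF simple] r dimr lt by auto
      show ?thesis
      proof (cases "r \<in> Sx")
        case True
        then have "x \<in> X r \<longleftrightarrow> y \<in> X r" using xy(3)[of "X r"] by (auto simp: XX_def)
        then show ?thesis using xy(1,2) e lt by (auto simp: X_def ones_def Om_def)
      next
        case False
        then have "Z r \<in> ZZ" using r by (auto simp: ZZ_def Sx_def Sz_def)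
        then have "x \<in> Z r \<longleftrightarrow> y \<in> Z r" by (rule xy(4))
        then show ?thesis using xy(1,2) e lt by (auto simp: Z_def zeros_def Om_def)
      qed
    qed
    then have "col A x = col A y" using lt dimr by (intro eq_vecI) auto
    then have "cols A ! x = cols A ! y" using lt by simp
    then show "x = y"
      using simple lt nth_eq_iff_index_eq[of "cols A" x y] by (simp add: simple_matrix_def)
  qed
  have cardXZ: "card XX + card ZZ \<le> m"
  proof -
    have "card XX \<le> card (X ` Sx)" unfolding XX_def using finS by (intro card_mono) auto
    also have "\<dots> \<le> card Sx" using finS(1) by (rule card_image_le)
    finally have "card XX \<le> card Sx" .
    moreover have "card ZZ \<le> card Sz" unfolding ZZ_def using finS(2) by (rule card_image_le)
    ultimately show ?thesis using cardS by linarith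
  qed

  \<comment> \<open>Identity blocks from the antichains\<close>
  obtain E F where EF: "finite E" "\<And>e. e \<in> E \<Longrightarrow> 2 ^ Suc e \<le> card XX"
    "\<And>e. e \<in> E \<Longrightarrow> F e \<subseteq> XX" "\<And>e. e \<in> E \<Longrightarrow> card (F e) = 2 ^ e"
    "\<And>e c d. e \<in> E \<Longrightarrow> c \<in> F e \<Longrightarrow> d \<in> F e \<Longrightarrow> c \<noteq> d \<Longrightarrow> c \<inter> d = {}"
    "\<And>e e'. e \<in> E \<Longrightarrow> e' \<in> E \<Longrightarrow> e \<noteq> e' \<Longrightarrow> F e \<inter> F e' = {}"
    "card Good \<le> 4 * t * card ZZ + 16 * (\<Sum>e\<in>E. \<Sum>c\<in>F e. w c)"
    using antichains by blast
  define C where "C e = (\<Union>c\<in>F e. K c)" for e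
  \<comment> \<open>By \<open>cross\<close>, a heavy row whose trimmed zero set lies inside no
    member of \<open>F e\<close> is either zero throughout a member or zero at fewer than
    \<open>t\<close> of its points; hence it is not dense.\<close>
  define R where "R e = {s \<in> Sz. \<forall>c\<in>F e. \<not> Z s \<subseteq> c}" for e
  define row where "row c = (SOME r. r \<in> Sx \<and> X r = c)" for c
  have row: "row c \<in> Sx" "X (row c) = c" if "c \<in> XX" for c
  proof -
    have "\<exists>r. r \<in> Sx \<and> X r = c" using that by (auto simp: XX_def)
    from someI_ex[OF this] show "row c \<in> Sx" "X (row c) = c" by (auto simp: row_def)
  qed
  define enum where "enum e = (SOME g. bij_betw g {..<2 ^ e :: nat} (F e))" for e
  have enum: "bij_betw (enum e) {..<2 ^ e} (F e)" if "e \<in> E" for e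
  proof -
    have "finite (F e)" using EF(3)[OF that] finite_XX by (rule finite_subset)
    then have "\<exists>g. bij_betw g {..<2 ^ e :: nat} (F e)"
      using ex_bij_betw_nat_finite[of "F e"] EF(4)[OF that] by (simp add: atLeast0LessThan)
    then show ?thesis unfolding enum_def by (rule someI_ex)
  qed
  \<comment> \<open>Row \<open>l\<close> has the \<open>l\<close>-th member of the antichain as its
    trimmed support; disjointness gives the identity pattern.\<close>
  define \<rho> where "\<rho> e l = row (enum e l)" for e l
  have K_Om: "K c \<subseteq> Om" for c using K_sub(2) by (auto simp: Good_def)
  have block: "id_block t A (2 ^ e) (R e) (C e) (\<rho> e)" if e: "e \<in> E" for e
  proof -
    let ?K = "\<lambda>i. K (enum e i)"
    have g: "enum e i \<in> F e" "enum e i \<in> XX" if "i < 2 ^ e" for i :: nat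
      using bij_betwE[OF enum[OF e]] EF(3)[OF e] that by auto
    have g_inj: "i = j" if "enum e i = enum e j" "i < 2 ^ e" "j < 2 ^ e" for i j :: nat
      using inj_onD[OF bij_betw_imp_inj_on[OF enum[OF e]] that(1)] that by simp
    have K_zeros: "?K i \<inter> zeros A s = ?K i \<inter> Z s" for i s
      using K_Om by (auto simp: Z_def Om_def)
    have "id_block t A (2 ^ e) (R e) (\<Union>i<2 ^ e. ?K i) (\<rho> e)"
    proof (rule id_blockI)
      show "R e \<subseteq> {..<dim_row A}" by (auto simp: R_def Sz_def dimr)
      show "(\<Union>i<2 ^ e. ?K i) \<subseteq> {..<dim_col A}" using K_Om by (auto simp: Om_def n_def)
      show "\<rho> e l < dim_row A" if "l < 2 ^ e" for l :: nat
        using row(1)[OF g(2)[OF that]] by (auto simp: \<rho>_def Sx_def dimr)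
      show "inj_on (\<rho> e) {..<2 ^ e}"
      proof (rule inj_onI)
        fix i j :: nat assume ij: "i \<in> {..<2 ^ e}" "j \<in> {..<2 ^ e}" "\<rho> e i = \<rho> e j"
        then have lt: "i < 2 ^ e" "j < 2 ^ e" by simp_all
        have "X (\<rho> e i) = enum e i" "X (\<rho> e j) = enum e j"
          unfolding \<rho>_def by (rule row(2)[OF g(2)[OF lt(1)]], rule row(2)[OF g(2)[OF lt(2)]])
        then have "enum e i = enum e j" unfolding ij(3) by (rule trans[OF sym])
        then show "i = j" using lt by (rule g_inj)
      qed
    next
      fix i l :: nat and x assume il: "i < 2 ^ e" "l < 2 ^ e" and x: "x \<in> ?K i"
      have xi: "x \<in> enum e i" "x \<in> Om" using x K_sub(1) K_Om by blast+
      have r: "\<rho> e l < dim_row A" "X (\<rho> e l) = enum e l"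
        using row[OF g(2)[OF il(2)]] by (auto simp: \<rho>_def Sx_def dimr)
      have "x \<in> enum e l \<longleftrightarrow> l = i"
        using EF(5)[OF e g(1)[OF il(1)] g(1)[OF il(2)]] xi(1) g_inj[OF _ il] by blast
      then have "x \<in> X (\<rho> e l) \<longleftrightarrow> l = i" by (simp add: r(2))
      then show "A $$ (\<rho> e l, x) = (if l = i then 1 else 0)"
        using simple_matrix_entry[OF simple r(1), of x] xi(2) by (auto simp: X_def ones_def Om_def n_def)
    next
      fix i :: nat and s assume i: "i < 2 ^ e" and s: "s \<in> R e"
      have "Z s \<in> ZZ" "\<not> Z s \<subseteq> enum e i" using s g(1)[OF i] by (auto simp: R_def ZZ_def)
      then consider "enum e i \<subseteq> Z s" | "card (enum e i \<inter> Z s) < t" using cross g(2)[OF i] by blast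
      then show "?K i \<subseteq> zeros A s \<or> card (?K i \<inter> zeros A s) < t"
      proof cases
        case 1
        then show ?thesis using K_sub(1) by (auto simp: Z_def)
      next
        case 2
        have "card (?K i \<inter> Z s) \<le> card (enum e i \<inter> Z s)"
          using finite_X[OF g(2)[OF i]] K_sub(1) by (intro card_mono) auto
        then show ?thesis using 2 by (simp add: K_zeros)
      qed
    next
      fix i :: nat and x assume i: "i < 2 ^ e" and x: "x \<in> ?K i"
      then have xG: "x \<in> Good" and tp: "tp x = enum e i" by (auto simp: K_def)
      obtain s where s: "s \<in> Sz" "Zm x = Z s" using Good_in(2)[OF xG] by (auto simp: ZZ_def)
      \<comment> \<open>A member of \<open>F e\<close> containing \<open>Z s\<close> contains
        \<open>x\<close>, so by disjointness it is \<open>tp x\<close>, which does not contain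
        \<open>Zm x\<close>.\<close>
      have "\<not> Z s \<subseteq> c" if c: "c \<in> F e" for c
      proof
        assume "Z s \<subseteq> c"
        then have "x \<in> c" using mem_Zm[of x] s(2) by auto
        then have "c = enum e i" using EF(5)[OF e c g(1)[OF i]] tp_props(2)[OF xG] tp by auto
        then show False using \<open>Z s \<subseteq> c\<close> tp_props(3)[OF xG] s(2) tp by simp
      qed
      then have "s \<in> R e" using s(1) by (simp add: R_def)
      moreover have "x \<in> zeros A s" using mem_Zm[of x] s(2) by (auto simp: Z_def)
      moreover have "card (?K i \<inter> zeros A s) < t"
      proof -
        have "card (?K i \<inter> Z s) \<le> card (enum e i \<inter> Z s)"
          using finite_X[OF g(2)[OF i]] K_sub(1) by (intro card_mono) auto
        then show ?thesis using tp_props(4)[OF xG] s(2) tp by (simp add: K_zeros)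
      qed
      ultimately show "\<exists>r\<in>R e. x \<in> zeros A r \<and> card (?K i \<inter> zeros A r) < t" by blast
    qed
    moreover have "(\<Union>i<2 ^ e. ?K i) = C e"
      unfolding C_def bij_betw_imp_surj_on[OF enum[OF e], symmetric] by simp
    ultimately show ?thesis by simp
  qed
  have finF: "finite (F e)" if "e \<in> E" for e using EF(3)[OF that] finite_XX by (rule finite_subset)
  have cardC: "card (C e) = (\<Sum>c\<in>F e. w c)" if "e \<in> E" for e
    unfolding C_def w_def using finF[OF that] finite_K by (intro card_UN_disjoint) (auto simp: K_def)
  have sumC: "(\<Sum>e\<in>E. card (C e)) = (\<Sum>e\<in>E. \<Sum>c\<in>F e. w c)"
    using cardC by (rule sum.cong[OF refl])
  show thesis
  proof (rule that[of E R C \<rho>])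
    show "finite E" by (rule EF(1))
    show "2 ^ Suc e \<le> m" if "e \<in> E" for e using EF(2)[OF that] cardXZ by linarith
    show "id_block t A (2 ^ e) (R e) (C e) (\<rho> e)" if "e \<in> E" for e by (rule block[OF that])
    have "(\<Sum>e\<in>E. \<Sum>c\<in>F e. w c) = (\<Sum>c\<in>(\<Union>e\<in>E. F e). w c)"
      using EF(1,6) finF by (intro sum.UNION_disjoint[symmetric]) auto
    also have "\<dots> = card (\<Union>c\<in>(\<Union>e\<in>E. F e). K c)"
      unfolding w_def using EF(1) finF finite_K
      by (intro card_UN_disjoint[symmetric]) (auto simp: K_def)
    also have "\<dots> \<le> card {..<n}" using K_Om by (intro card_mono) (auto simp: Om_def)
    finally show "(\<Sum>e\<in>E. card (C e)) \<le> dim_col A" by (simp add: sumC n_def)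
    have "n \<le> card D + card Om"
    proof -
      have "{..<n} \<subseteq> D \<union> Om" by (auto simp: Om_def)
      moreover have "finite D"
        using Dx(3) Dz(3) finS fin_ones by (auto simp: D_def intro: finite_subset)
      ultimately have "card {..<n} \<le> card (D \<union> Om)" using finite_Om by (intro card_mono) auto
      then show ?thesis using card_Un_le[of D Om] by simp
    qed
    moreover have "card Om \<le> card (Om - Good) + card Good"
    proof -
      have "Om = (Om - Good) \<union> Good" by (auto simp: Good_def)
      then show ?thesis using card_Un_le[of "Om - Good" Good] by simp
    qed
    moreover have "4 * t * card ZZ \<le> 4 * t * m" using cardXZ by simp
    moreover have "m + 2 \<le> 2 * (t * m)"
    proof -
      have "2 * m \<le> t * m" using t by simp
      then show ?thesis using m by linarith
    qed
    \<comment> \<open>In units of \<open>t * m\<close>, the loss is at most 1 for the deletion, 2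
      for the points that are not good and 4 for the lonely sets. With 14 in \<open>large\<close>
      this is at most half of \<open>n\<close>, which doubles 16 to 32.\<close>
    ultimately have "n \<le> 7 * (t * m) + 16 * (\<Sum>e\<in>E. card (C e))"
      using cardD card_not_Good cardXZ EF(7) sumC by linarith
    then show "dim_col A \<le> 32 * (\<Sum>e\<in>E. card (C e))" using large by (simp add: n_def)
  qed
qed

section \<open>The decomposition\<close>

lemma dim_col_submatrix:
  assumes "J \<subseteq> {..<dim_col A}"
  shows "dim_col (submatrix A I J) = card J"
proof -
  have "{j. j < dim_col A \<and> j \<in> J} = J" using assms by auto
  then show ?thesis by (simp add: dim_submatrix)
qed

text \<open>The condition on \<open>2 ^ y\<close> bounds \<open>y\<close> by the binary logarithm of
  the number of rows; the factors 32 and 1, independent of \<open>A\<close>, provide the two halves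
  of \<open>\<Theta>\<close>.\<close>

definition id_decomposition ::
  "nat \<Rightarrow> nat mat \<Rightarrow> nat \<Rightarrow> (nat \<Rightarrow> nat) \<Rightarrow> (nat \<Rightarrow> nat set) \<Rightarrow> (nat \<Rightarrow> nat set) \<Rightarrow>
    (nat \<Rightarrow> nat \<Rightarrow> nat) \<Rightarrow> bool" where
  "id_decomposition t A y k R C \<rho> \<longleftrightarrow>
     (\<forall>j\<in>{1..y}. 0 < k j \<and> id_block t A (k j) (R j) (C j) (\<rho> j)) \<and>
     (\<forall>j. 1 \<le> j \<and> j < y \<longrightarrow> 2 * k (j + 1) \<le> k j) \<and> 2 ^ y \<le> dim_row A \<and>
     dim_col A \<le> 32 * (\<Sum>j=1..y. card (C j)) \<and> (\<Sum>j=1..y. card (C j)) \<le> dim_col A"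

lemma Avoid_Q3_id_decomposition:
  assumes "2 \<le> t" "A \<in> Avoid m (Q3 t)" "1 \<le> m" "14 * t * m \<le> dim_col A"
  shows "\<exists>y k R C \<rho>. id_decomposition t A y k R C \<rho>"
proof -
  obtain E R C \<rho> where E: "finite E" "\<And>e. e \<in> E \<Longrightarrow> 2 ^ Suc e \<le> m"
    and block: "\<And>e. e \<in> E \<Longrightarrow> id_block t A (2 ^ e) (R e) (C e) (\<rho> e)"
    and sums: "dim_col A \<le> 32 * (\<Sum>e\<in>E. card (C e))" "(\<Sum>e\<in>E. card (C e)) \<le> dim_col A"
    using Avoid_Q3_id_blocks[OF assms] by blast
  define es where "es = sorted_list_of_set E"
  define y where "y = card E"
  \<comment> \<open>Reads the sorted exponents from the largest down, for positions starting at
    1.\<close>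
  define e where "e j = es ! (y - j)" for j
  have es: "length es = y" "set es = E" "distinct es" "sorted_wrt (<) es"
    using E(1) by (auto simp: es_def y_def)
  have bij: "bij_betw e {1..y} E"
  proof -
    have "bij_betw (\<lambda>j. y - j) {1..y} {..<y}"
      by (rule bij_betwI[where g = "\<lambda>i. y - i"]) auto
    moreover have "bij_betw ((!) es) {..<y} E"
      using bij_betw_nth[OF es(3), of "{..<y}" E] es(1,2) by simp
    ultimately have "bij_betw ((!) es \<circ> (\<lambda>j. y - j)) {1..y} E" by (rule bij_betw_trans)
    then show ?thesis by (simp add: e_def comp_def cong: bij_betw_cong)
  qed
  then have eE: "e j \<in> E" if "j \<in> {1..y}" for j using that by (rule bij_betw_apply)
  have sum_e: "(\<Sum>j=1..y. card (C (e j))) = (\<Sum>e\<in>E. card (C e))"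
    using bij by (rule sum.reindex_bij_betw)
  have "2 * 2 ^ e (j + 1) \<le> (2 ^ e j :: nat)" if "1 \<le> j" "j < y" for j
  proof -
    have "e (j + 1) < e j"
      unfolding e_def using that es(1) by (intro sorted_wrt_nth_less[OF es(4)]) auto
    then have "Suc (e (j + 1)) \<le> e j" by simp
    then have "2 ^ Suc (e (j + 1)) \<le> (2 ^ e j :: nat)" by (intro power_increasing) auto
    then show ?thesis by simp
  qed
  \<comment> \<open>The largest of \<open>y\<close> distinct exponents is at least
    \<open>y - 1\<close>; the \<open>Suc\<close> in the bound on \<open>E\<close> makes up for the
    1.\<close>
  moreover have "2 ^ y \<le> m"
  proof (cases "E = {}")
    case False
    have "E \<subseteq> {..Max E}" using E(1) by auto
    then have "card E \<le> card {..Max E}" by (intro card_mono) auto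
    then have "y \<le> Suc (Max E)" by (simp add: y_def)
    then have "2 ^ y \<le> (2 ^ Suc (Max E) :: nat)" by (intro power_increasing) auto
    also have "\<dots> \<le> m" using E False by (intro E(2) Max_in)
    finally show ?thesis .
  qed (use assms(3) in \<open>simp add: y_def\<close>)
  moreover have "dim_row A = m" using assms(2) by (simp add: Avoid_def)
  ultimately have "id_decomposition t A y (\<lambda>j. 2 ^ e j) (\<lambda>j. R (e j)) (\<lambda>j. C (e j)) (\<lambda>j. \<rho> (e j))"
    unfolding id_decomposition_def using block eE sums by (simp add: sum_e del: One_nat_def)
  then show ?thesis by blast
qed

theorem theorem4p3:
  fixes t :: nat and A :: "nat \<Rightarrow> nat mat"
  assumes "t \<ge> 2"
    and "\<And>m. m \<ge> 1 \<Longrightarrow> A m \<in> Avoid m (Q3 t)"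
    and "(\<lambda>m. real (dim_col (A m))) \<in> \<omega>(\<lambda>m. real m * log 2 (real m))"
  shows "\<exists>(y :: nat \<Rightarrow> nat) (k :: nat \<Rightarrow> nat \<Rightarrow> nat)
           (R :: nat \<Rightarrow> nat \<Rightarrow> nat set) (C :: nat \<Rightarrow> nat \<Rightarrow> nat set)
           (\<rho> :: nat \<Rightarrow> nat \<Rightarrow> nat \<Rightarrow> nat).
      (\<forall>\<^sub>F m in sequentially.
         (\<forall>j\<in>{1..y m}. k m j > 0 \<and>
            R m j \<subseteq> {..<dim_row (A m)} \<and> C m j \<subseteq> {..<dim_col (A m)} \<and>
            is_configuration (submatrix (A m) (R m j) (C m j)) (A m)) \<and>
         (\<forall>j. 1 \<le> j \<and> j < y m \<longrightarrow> real (k m (j + 1)) \<le> 1 / 2 * real (k m j)) \<and>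
         real (y m) \<le> log 2 (real m) \<and>
         (\<forall>j\<in>{1..y m}.
            inj_on (\<rho> m j) {..<k m j} \<and> \<rho> m j ` {..<k m j} \<subseteq> {..<dim_row (A m)} \<and>
            (\<forall>c\<in>C m j. \<exists>i<k m j.
               restricted_col (A m) (k m j) (\<rho> m j) c = col (1\<^sub>m (k m j)) i) \<and>
            (\<forall>i<k m j.
               (\<forall>r\<in>R m j. \<not> dense_row t (A m) (id_class (A m) (C m j) (k m j) (\<rho> m j) i) r) \<and>
               (\<forall>c\<in>id_class (A m) (C m j) (k m j) (\<rho> m j) i.
                  \<exists>r\<in>R m j. identified_by t (A m)
                    (id_class (A m) (C m j) (k m j) (\<rho> m j) i) c r)))) \<and>
      (\<lambda>m. real (dim_col (A m))) \<in>
        \<Theta>(\<lambda>m. \<Sum>j=1..y m. real (dim_col (submatrix (A m) (R m j) (C m j))))"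
proof -
  have "\<forall>\<^sub>F m in sequentially. real (14 * t) * norm (real m * log 2 (real m)) \<le> norm (real (dim_col (A m)))"
    by (rule landau_omega.smallD[OF assms(3)]) (use assms(1) in simp)
  then have "\<forall>\<^sub>F m in sequentially. 2 \<le> m \<and> 14 * t * m \<le> dim_col (A m)"
    using eventually_ge_at_top[of 2]
  proof eventually_elim
    case (elim m)
    have "1 \<le> log 2 (real m)" using elim(2) by (simp add: le_log_iff)
    then have "real (14 * t) * (real m * 1) \<le> real (14 * t) * (real m * log 2 (real m))"
      by (intro mult_left_mono) auto
    also have "\<dots> \<le> real (dim_col (A m))" using elim(1) \<open>1 \<le> log 2 (real m)\<close> by simp
    finally have "real (14 * t * m) \<le> real (dim_col (A m))" by simp
    then show ?case using elim(2) by (simp only: of_nat_le_iff)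
  qed
  then have ex: "\<forall>\<^sub>F m in sequentially. \<exists>y k R C \<rho>. id_decomposition t (A m) y k R C \<rho>"
  proof eventually_elim
    case (elim m)
    then show ?case using Avoid_Q3_id_decomposition[OF assms(1) assms(2)[of m]] by simp
  qed
  \<comment> \<open>The guard makes a choice possible for every \<open>m\<close>; where no
    decomposition exists the values are arbitrary.\<close>
  have "\<forall>m. \<exists>y k R C \<rho>. (\<exists>y k R C \<rho>. id_decomposition t (A m) y k R C \<rho>) \<longrightarrow>
      id_decomposition t (A m) y k R C \<rho>"
    by blast
  then obtain y k R C \<rho> where sel: "\<And>m. \<exists>y k R C \<rho>. id_decomposition t (A m) y k R C \<rho> \<Longrightarrow>
      id_decomposition t (A m) (y m) (k m) (R m) (C m) (\<rho> m)"
    unfolding choice_iff by blast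
  have ev: "\<forall>\<^sub>F m in sequentially. 1 \<le> m \<and> id_decomposition t (A m) (y m) (k m) (R m) (C m) (\<rho> m)"
    using ex eventually_ge_at_top[of 1] by eventually_elim (use sel in blast)
  show ?thesis
  proof (intro exI conjI)
    show "\<forall>\<^sub>F m in sequentially.
         (\<forall>j\<in>{1..y m}. k m j > 0 \<and>
            R m j \<subseteq> {..<dim_row (A m)} \<and> C m j \<subseteq> {..<dim_col (A m)} \<and>
            is_configuration (submatrix (A m) (R m j) (C m j)) (A m)) \<and>
         (\<forall>j. 1 \<le> j \<and> j < y m \<longrightarrow> real (k m (j + 1)) \<le> 1 / 2 * real (k m j)) \<and>
         real (y m) \<le> log 2 (real m) \<and>
         (\<forall>j\<in>{1..y m}.
            inj_on (\<rho> m j) {..<k m j} \<and> \<rho> m j ` {..<k m j} \<subseteq> {..<dim_row (A m)} \<and>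
            (\<forall>c\<in>C m j. \<exists>i<k m j.
               restricted_col (A m) (k m j) (\<rho> m j) c = col (1\<^sub>m (k m j)) i) \<and>
            (\<forall>i<k m j.
               (\<forall>r\<in>R m j. \<not> dense_row t (A m) (id_class (A m) (C m j) (k m j) (\<rho> m j) i) r) \<and>
               (\<forall>c\<in>id_class (A m) (C m j) (k m j) (\<rho> m j) i.
                  \<exists>r\<in>R m j. identified_by t (A m)
                    (id_class (A m) (C m j) (k m j) (\<rho> m j) i) c r)))"
      using ev
    proof eventually_elim
      case (elim m)
      then have dec: "id_decomposition t (A m) (y m) (k m) (R m) (C m) (\<rho> m)" by simp
      have "dim_row (A m) = m" using assms(2)[of m] elim by (simp add: Avoid_def)
      then have "2 ^ y m \<le> m" using dec by (simp add: id_decomposition_def)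
      then have y: "real (y m) \<le> log 2 (real m)" by (rule le_log2_of_power)
      have block: "id_block t (A m) (k m j) (R m j) (C m j) (\<rho> m j)" "0 < k m j" if "j \<in> {1..y m}" for j
        using dec that unfolding id_decomposition_def by blast+
      have half: "real (k m (j + 1)) \<le> 1 / 2 * real (k m j)" if "1 \<le> j" "j < y m" for j
      proof -
        have "2 * k m (j + 1) \<le> k m j" using dec that unfolding id_decomposition_def by blast
        then have "real (2 * k m (j + 1)) \<le> real (k m j)" by (simp only: of_nat_le_iff)
        then show ?thesis by simp
      qed
      show ?case
      proof (intro conjI)
        show "\<forall>j\<in>{1..y m}. k m j > 0 \<and>
            R m j \<subseteq> {..<dim_row (A m)} \<and> C m j \<subseteq> {..<dim_col (A m)} \<and>
            is_configuration (submatrix (A m) (R m j) (C m j)) (A m)"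
          using block unfolding id_block_def by (meson is_configuration_submatrix)
      qed (use y half block[unfolded id_block_def] in blast)+
    qed
  next
    have *: "\<forall>\<^sub>F m in sequentially.
        real (dim_col (A m)) \<le> 32 * (\<Sum>j=1..y m. real (dim_col (submatrix (A m) (R m j) (C m j)))) \<and>
        (\<Sum>j=1..y m. real (dim_col (submatrix (A m) (R m j) (C m j)))) \<le> real (dim_col (A m))"
      using ev
    proof eventually_elim
      case (elim m)
      then have dec: "id_decomposition t (A m) (y m) (k m) (R m) (C m) (\<rho> m)" by simp
      have "(\<Sum>j=1..y m. dim_col (submatrix (A m) (R m j) (C m j))) = (\<Sum>j=1..y m. card (C m j))"
      proof (intro sum.cong refl dim_col_submatrix)
        show "C m j \<subseteq> {..<dim_col (A m)}" if "j \<in> {1..y m}" for j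
          using dec that unfolding id_decomposition_def id_block_def by blast
      qed
      then have "dim_col (A m) \<le> 32 * (\<Sum>j=1..y m. dim_col (submatrix (A m) (R m j) (C m j)))"
        "(\<Sum>j=1..y m. dim_col (submatrix (A m) (R m j) (C m j))) \<le> dim_col (A m)"
        using dec unfolding id_decomposition_def by auto
      then have "real (dim_col (A m)) \<le> real (32 * (\<Sum>j=1..y m. dim_col (submatrix (A m) (R m j) (C m j))))"
        "real (\<Sum>j=1..y m. dim_col (submatrix (A m) (R m j) (C m j))) \<le> real (dim_col (A m))"
        by (simp_all only: of_nat_le_iff)
      then show ?case by simp
    qed
    show "(\<lambda>m. real (dim_col (A m))) \<in>
        \<Theta>(\<lambda>m. \<Sum>j=1..y m. real (dim_col (submatrix (A m) (R m j) (C m j))))"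
    proof (rule bigthetaI)
      show "(\<lambda>m. real (dim_col (A m))) \<in>
          O(\<lambda>m. \<Sum>j=1..y m. real (dim_col (submatrix (A m) (R m j) (C m j))))"
        by (rule landau_o.bigI[of 32]) (use * in \<open>auto elim!: eventually_mono\<close>)
      show "(\<lambda>m. real (dim_col (A m))) \<in>
          \<Omega>(\<lambda>m. \<Sum>j=1..y m. real (dim_col (submatrix (A m) (R m j) (C m j))))"
        by (rule landau_omega.bigI[of 1])
          (use * in \<open>auto elim!: eventually_mono simp: abs_of_nonneg sum_nonneg\<close>)
    qed
  qed
qed

end
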